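(* Let $p$ be a prime and let $A$ be a Henselian valuation ring which is not a field (of arbitrary rank), with field of fractions $K$ and residue field $k$, where $\operatorname{char}K=\operatorname{char}k=p$. Let $L/K$ be a non-trivial Artin–Schreier extension (of degree $p$), let $B$ be the integral closure of $A$ in $L$, and let $\sigma$ be a generator of $\operatorname{Gal}(L/K)$. Then the following equality of ideals of $A$ holds: $$\mathscr{H}=\big(N_{L/K}(\mathscr{J}_\sigma)\big).$$
   Context: $\mathscr{J}_\sigma$ is the ideal of $B$ generated by $\{\sigma(b)/b-1\mid b\in L^\times\}$ (it does not depend on the choice of $\sigma$). $\big(N_{L/K}(\mathscr{J}_\sigma)\big)$ denotes the ideal of $A$ generated by the norms $N_{L/K}(x)$, $x\in\mathscr{J}_\sigma$. $\mathscr{H}$ is the $A$-submodule of $K$ generated by $\{1/h\mid h\in K^\times$ such that the solutions of $T^p-T=h$ generate $L/K\}$ (it is an integral ideal of $A$). *)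

theory Defs
  imports Main "HOL-Computational_Algebra.Polynomial"
begin

text \<open>Throughout, the ambient field type 'a plays the role of the extension field L;
  K, A, B are subsets of it.\<close>

definition is_subfield :: "'a::field set \<Rightarrow> bool" where
  "is_subfield F \<longleftrightarrow> 0 \<in> F \<and> 1 \<in> F \<and>
     (\<forall>x\<in>F. \<forall>y\<in>F. x + y \<in> F \<and> x - y \<in> F \<and> x * y \<in> F) \<and>
     (\<forall>x\<in>F. inverse x \<in> F)"

definition is_subring :: "'a::field set \<Rightarrow> bool" where
  "is_subring R \<longleftrightarrow> 0 \<in> R \<and> 1 \<in> R \<and>
     (\<forall>x\<in>R. \<forall>y\<in>R. x + y \<in> R \<and> x - y \<in> R \<and> x * y \<in> R)"

definition adjoin :: "'a::field set \<Rightarrow> 'a set \<Rightarrow> 'a set" where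
  "adjoin K S = \<Inter>{F. is_subfield F \<and> K \<subseteq> F \<and> S \<subseteq> F}"

definition valuation_ring_of :: "'a::field set \<Rightarrow> 'a set \<Rightarrow> bool" where
  "valuation_ring_of A K \<longleftrightarrow> is_subring A \<and> A \<subseteq> K \<and>
     (\<forall>x\<in>K. x \<noteq> 0 \<longrightarrow> x \<in> A \<or> inverse x \<in> A)"

definition fraction_field_of :: "'a::field set \<Rightarrow> 'a set \<Rightarrow> bool" where
  "fraction_field_of A K \<longleftrightarrow> K = {a / b | a b. a \<in> A \<and> b \<in> A \<and> b \<noteq> 0}"

definition max_ideal :: "'a::field set \<Rightarrow> 'a set" where
  "max_ideal A = {x \<in> A. x = 0 \<or> inverse x \<notin> A}"

definition henselian :: "'a::field set \<Rightarrow> bool" where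
  "henselian A \<longleftrightarrow> (\<forall>f a. (\<forall>i. coeff f i \<in> A) \<and> lead_coeff f = 1 \<and> a \<in> A \<and>
      poly f a \<in> max_ideal A \<and> poly (pderiv f) a \<notin> max_ideal A \<longrightarrow>
      (\<exists>b\<in>A. poly f b = 0 \<and> b - a \<in> max_ideal A))"

definition integral_closure :: "'a::field set \<Rightarrow> 'a set" where
  "integral_closure A = {x. \<exists>f. (\<forall>i. coeff f i \<in> A) \<and> lead_coeff f = 1 \<and> poly f x = 0}"

definition nontrivial_AS_ext :: "nat \<Rightarrow> 'a::field set \<Rightarrow> bool" where
  "nontrivial_AS_ext p K \<longleftrightarrow> K \<noteq> UNIV \<and>
     (\<exists>h\<in>K. adjoin K {\<theta>. \<theta> ^ p - \<theta> = h} = UNIV)"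

definition Gal :: "'a::field set \<Rightarrow> ('a \<Rightarrow> 'a) set" where
  "Gal K = {\<tau>. bij \<tau> \<and> (\<forall>x y. \<tau> (x + y) = \<tau> x + \<tau> y \<and> \<tau> (x * y) = \<tau> x * \<tau> y)
              \<and> \<tau> 1 = 1 \<and> (\<forall>x\<in>K. \<tau> x = x)}"

definition generates_Gal :: "'a::field set \<Rightarrow> ('a \<Rightarrow> 'a) \<Rightarrow> bool" where
  "generates_Gal K \<sigma> \<longleftrightarrow> \<sigma> \<in> Gal K \<and> Gal K = {\<sigma> ^^ n | n. True}"

text \<open>Norm N_{L/K}(x) as the product of the Galois conjugates (L/K is Galois).\<close>
definition norm_LK :: "'a::field set \<Rightarrow> 'a \<Rightarrow> 'a" where
  "norm_LK K x = (\<Prod>\<tau>\<in>Gal K. \<tau> x)"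

definition gen_module :: "'a::field set \<Rightarrow> 'a set \<Rightarrow> 'a set" where
  "gen_module R S = {x. \<exists>(n::nat) r s. x = (\<Sum>i<n. r i * s i) \<and> (\<forall>i<n. r i \<in> R \<and> s i \<in> S)}"

definition J_sigma :: "'a::field set \<Rightarrow> ('a \<Rightarrow> 'a) \<Rightarrow> 'a set" where
  "J_sigma B \<sigma> = gen_module B {\<sigma> b / b - 1 | b. b \<noteq> 0}"

definition H_module :: "nat \<Rightarrow> 'a::field set \<Rightarrow> 'a set \<Rightarrow> 'a set" where
  "H_module p A K = gen_module A
     {1 / h | h. h \<in> K \<and> h \<noteq> 0 \<and> adjoin K {\<theta>. \<theta> ^ p - \<theta> = h} = UNIV}"

end

theory Submission
  imports Defs "Jordan_Normal_Form.Char_Poly" "HOL-Algebra.Algebraic_Closure_Type" "HOL-Number_Theory.Cong"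
begin

text \<open>
  Write \<open>L = K(\<theta>)\<close> with \<open>\<theta>\<^sup>p - \<theta> \<in> K\<close> and \<open>\<sigma> \<theta> = \<theta> + 1\<close>. For any generator \<open>\<alpha>\<close> of this kind,
  \<open>\<sigma> \<alpha> / \<alpha> - 1 = 1 / \<alpha>\<close> and \<open>N \<alpha> = \<alpha>\<^sup>p - \<alpha>\<close>, so \<open>1 / h = N (1 / \<alpha>)\<close> is a norm from \<open>\<J>\<^sub>\<sigma>\<close>. As \<open>B\<close> is
  a valuation ring, the reverse inclusion amounts to finding, for each \<open>b \<noteq> 0\<close> in \<open>L\<close>, some \<open>c \<in> K\<close> such
  that \<open>(\<sigma> b / b - 1) (\<theta> - c) \<in> B\<close>.

  Put \<open>\<rho> = b / (\<sigma> b - b)\<close> and suppose that \<open>|\<theta> - c| > |\<rho>|\<close> for all \<open>c \<in> K\<close>. If every nonzero \<open>g \<in> K[T]\<close> of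
  degree less than \<open>p\<close> satisfies \<open>g (\<theta> + \<rho> T) = g (\<theta>) (1 + \<dots>)\<close> with all other coefficients in the maximal
  ideal, then the choice \<open>g (\<theta>) = b\<close>, \<open>T = 1 / \<rho>\<close> gives \<open>|\<sigma> b - b| < |b / \<rho>|\<close>, a contradiction. Otherwise,
  a \<open>g\<close> of minimal degree violating this reduces to a linear polynomial. Then so does the polynomial \<open>Q\<close> over
  \<open>K\<close> with \<open>Q (T\<^sup>p - T) = \<Prod>g (T + i)\<close>, after scaling, and Hensel's lemma over \<open>A\<close> produces a root \<open>h'\<close> of \<open>Q\<close>
  close to \<open>\<theta>\<^sup>p - \<theta>\<close>. Since \<open>T\<^sup>p - T - h'\<close> shares a root with some \<open>g (T + i)\<close> and \<open>deg g < p\<close>, it has a root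
  \<open>c \<in> K\<close>, and \<open>|\<theta> - c| \<le> |\<rho>|\<close>.
\<close>

section \<open>Integral closure\<close>

hide_const (open) UnivPoly.coeff UnivPoly.monom Module.smult Polynomials.lead_coeff Polynomials.degree
  Divisibility.prime Coset.order

section \<open>Subrings, subfields and polynomials with coefficients in a given set\<close>

lemma is_subfield_imp_subring: "is_subfield F \<Longrightarrow> is_subring F"
  by (auto simp: is_subfield_def is_subring_def)

lemma is_subringD:
  assumes "is_subring R"
  shows "0 \<in> R" "1 \<in> R" "x \<in> R \<Longrightarrow> y \<in> R \<Longrightarrow> x + y \<in> R" "x \<in> R \<Longrightarrow> y \<in> R \<Longrightarrow> x - y \<in> R"
    "x \<in> R \<Longrightarrow> y \<in> R \<Longrightarrow> x * y \<in> R" "x \<in> R \<Longrightarrow> - x \<in> R"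
proof -
  show *: "0 \<in> R" "1 \<in> R" "x \<in> R \<Longrightarrow> y \<in> R \<Longrightarrow> x + y \<in> R" "x \<in> R \<Longrightarrow> y \<in> R \<Longrightarrow> x - y \<in> R"
    "x \<in> R \<Longrightarrow> y \<in> R \<Longrightarrow> x * y \<in> R" for x y
    using assms by (auto simp: is_subring_def)
  show "x \<in> R \<Longrightarrow> - x \<in> R"
    using *(4)[of 0 x] *(1) by simp
qed

lemma is_subfieldD:
  assumes "is_subfield R"
  shows "x \<in> R \<Longrightarrow> inverse x \<in> R" "x \<in> R \<Longrightarrow> y \<in> R \<Longrightarrow> x / y \<in> R"
  using assms by (auto simp: is_subfield_def divide_inverse)

lemma subring_sum:
  assumes "is_subring R" "\<And>i. i \<in> I \<Longrightarrow> f i \<in> R"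
  shows "sum f I \<in> R"
  using assms(2) by (induction I rule: infinite_finite_induct) (auto intro: is_subringD[OF assms(1)])

lemma subring_prod:
  assumes "is_subring R" "\<And>i. i \<in> I \<Longrightarrow> f i \<in> R"
  shows "prod f I \<in> R"
  using assms(2) by (induction I rule: infinite_finite_induct) (auto intro: is_subringD[OF assms(1)])

lemma subring_power: "is_subring R \<Longrightarrow> x \<in> R \<Longrightarrow> x ^ n \<in> R"
  by (induction n) (auto intro: is_subringD)

lemma subring_of_nat: "is_subring R \<Longrightarrow> of_nat n \<in> R"
  by (induction n) (auto intro: is_subringD)

definition polys_over :: "'a::zero set \<Rightarrow> 'a poly set" where
  "polys_over R = {f. \<forall>i. coeff f i \<in> R}"

lemma polys_overI: "(\<And>i. coeff f i \<in> R) \<Longrightarrow> f \<in> polys_over R"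
  by (simp add: polys_over_def)

lemma polys_overD: "f \<in> polys_over R \<Longrightarrow> coeff f i \<in> R"
  by (simp add: polys_over_def)

lemma polys_over_mono: "R \<subseteq> S \<Longrightarrow> f \<in> polys_over R \<Longrightarrow> f \<in> polys_over S"
  by (auto simp: polys_over_def)

text \<open>Stated for an ideal so as to serve twice: \<open>M = R\<close> makes
  \<open>polys_over R\<close> closed under products, and the maximal ideal of \<open>B\<close> makes
  congruence modulo it compatible with them.\<close>

lemma polys_over_ideal_mult:
  fixes M :: "'a::comm_ring_1 set"
  assumes M: "0 \<in> M" "\<And>x y. x \<in> M \<Longrightarrow> y \<in> M \<Longrightarrow> x + y \<in> M" "\<And>x y. x \<in> M \<Longrightarrow> y \<in> R \<Longrightarrow> x * y \<in> M"
    and f: "f \<in> polys_over M" and g: "g \<in> polys_over R"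
  shows "f * g \<in> polys_over M"
proof (rule polys_overI)
  fix n
  have *: "sum h I \<in> M" if "\<And>i. i \<in> I \<Longrightarrow> h i \<in> M" for h and I :: "nat set"
    using that by (induction I rule: infinite_finite_induct) (auto intro: M)
  show "coeff (f * g) n \<in> M"
    unfolding coeff_mult by (intro * M(3) polys_overD[OF f] polys_overD[OF g])
qed

lemma polys_over_closed:
  assumes "is_subring R"
  shows "0 \<in> polys_over R" "1 \<in> polys_over R"
    "f \<in> polys_over R \<Longrightarrow> g \<in> polys_over R \<Longrightarrow> f + g \<in> polys_over R"
    "f \<in> polys_over R \<Longrightarrow> g \<in> polys_over R \<Longrightarrow> f - g \<in> polys_over R"
    "f \<in> polys_over R \<Longrightarrow> g \<in> polys_over R \<Longrightarrow> f * g \<in> polys_over R"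
    "c \<in> R \<Longrightarrow> f \<in> polys_over R \<Longrightarrow> smult c f \<in> polys_over R"
    "c \<in> R \<Longrightarrow> f \<in> polys_over R \<Longrightarrow> pCons c f \<in> polys_over R"
    "c \<in> R \<Longrightarrow> monom c n \<in> polys_over R"
    "f \<in> polys_over R \<Longrightarrow> pderiv f \<in> polys_over R"
    "f \<in> polys_over R \<Longrightarrow> g \<in> polys_over R \<Longrightarrow> pcompose f g \<in> polys_over R"
    "f \<in> polys_over R \<Longrightarrow> x \<in> R \<Longrightarrow> poly f x \<in> R"
proof -
  note R = is_subringD[OF assms]
  show mult: "f \<in> polys_over R \<Longrightarrow> g \<in> polys_over R \<Longrightarrow> f * g \<in> polys_over R" for f g
    by (rule polys_over_ideal_mult) (auto intro: R)
  show "f \<in> polys_over R \<Longrightarrow> g \<in> polys_over R \<Longrightarrow> pcompose f g \<in> polys_over R"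
    unfolding polys_over_def mem_Collect_eq
    by (intro allI coeff_pcompose_semiring_closed) (auto intro: R)
  show "f \<in> polys_over R \<Longrightarrow> x \<in> R \<Longrightarrow> poly f x \<in> R"
    unfolding poly_altdef polys_over_def
    by (intro subring_sum[OF assms] R subring_power[OF assms]) auto
  show "f \<in> polys_over R \<Longrightarrow> pderiv f \<in> polys_over R"
    by (auto simp: polys_over_def coeff_pderiv simp del: of_nat_Suc intro!: R subring_of_nat[OF assms])
qed (use assms in \<open>auto simp: polys_over_def coeff_pCons coeff_monom coeff_1 split: nat.splits intro: is_subringD[OF assms]\<close>)

lemma polys_over_prod:
  assumes "is_subring R" "\<And>i. i \<in> I \<Longrightarrow> f i \<in> polys_over R"
  shows "prod f I \<in> polys_over R"
  using assms(2)
  by (induction I rule: infinite_finite_induct) (auto intro: polys_over_closed[OF assms(1)])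

text \<open>As \<open>g\<close> is monic, cancelling the leading term of \<open>f\<close> never
  requires a division, so all coefficients stay in \<open>R\<close>.\<close>

lemma polys_over_divmod_monic:
  assumes R: "is_subring R" and g: "g \<in> polys_over R" "lead_coeff g = 1" and f: "f \<in> polys_over R"
  obtains q r where "q \<in> polys_over R" "r \<in> polys_over R" "f = g * q + r" "r = 0 \<or> degree r < degree g"
  using f
proof (induction "degree f" arbitrary: f thesis rule: less_induct)
  case (less f)
  show ?case
  proof (cases "f = 0 \<or> degree f < degree g")
    case True
    then show ?thesis
      using less.prems(1)[of 0 f] less.prems(2) polys_over_closed[OF R] by auto
  next
    case False
    define m where "m = monom (lead_coeff f) (degree f - degree g)"
    define f' where "f' = f - g * m"
    have m: "m \<in> polys_over R"
      unfolding m_def by (intro polys_over_closed[OF R] polys_overD less.prems)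
    have f': "f' \<in> polys_over R"
      unfolding f'_def by (intro polys_over_closed[OF R] g m less.prems)
    have [simp]: "m \<noteq> 0" "degree m = degree f - degree g" "g \<noteq> 0"
      using False g(2) by (auto simp: m_def degree_monom_eq)
    have deg: "degree (g * m) = degree f"
      using False by (simp add: degree_mult_eq)
    have lc: "lead_coeff (g * m) = lead_coeff f"
      by (simp add: lead_coeff_mult g(2)) (simp add: m_def)
    have "f' = 0 \<or> degree f' < degree f"
    proof (cases "degree f = 0")
      case True
      then show ?thesis
        using deg lc by (auto simp: f'_def elim!: degree_eq_zeroE)
    next
      case False
      have "degree f' < degree f"
        unfolding f'_def by (rule degree_lessI)
          (use False deg lc in \<open>auto simp: le_less coeff_eq_0\<close>)
      then show ?thesis ..
    qed
    then obtain q r where "q \<in> polys_over R" "r \<in> polys_over R" "f' = g * q + r"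
      "r = 0 \<or> degree r < degree g"
    proof
      assume "f' = 0"
      then show ?thesis
        using that[of 0 0] polys_over_closed[OF R] by auto
    next
      assume "degree f' < degree f"
      then show ?thesis
        using less.hyps[OF _ _ f'] that by blast
    qed
    then show ?thesis
      by (intro less.prems(1)[of "q + m" r])
        (auto intro: polys_over_closed[OF R] m simp: f'_def algebra_simps)
  qed
qed

section \<open>Integral elements form a ring\<close>

lemma integral_closure_iff:
  "x \<in> integral_closure A \<longleftrightarrow> (\<exists>f\<in>polys_over A. lead_coeff f = 1 \<and> poly f x = 0)"
  by (auto simp: integral_closure_def polys_over_def)

text \<open>The determinant trick: \<open>z\<close> is an eigenvalue of a matrix over
  \<open>A\<close> with eigenvector \<open>v\<close>, hence a root of the characteristic polynomial,
  which is monic over \<open>A\<close>.\<close>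

lemma integral_closureI_matrix:
  fixes z :: "'a::field" and v :: "'i \<Rightarrow> 'a"
  assumes A: "is_subring A" and I: "finite I"
    and C: "\<And>i j. i \<in> I \<Longrightarrow> j \<in> I \<Longrightarrow> C i j \<in> A"
    and ev: "\<And>i. i \<in> I \<Longrightarrow> z * v i = (\<Sum>j\<in>I. C i j * v j)"
    and nz: "i0 \<in> I" "v i0 \<noteq> 0"
  shows "z \<in> integral_closure A"
proof -
  define n where "n = card I"
  obtain e where e: "bij_betw e {..<n} I"
    using ex_bij_betw_nat_finite[OF I] by (auto simp: n_def atLeast0LessThan)
  have eI: "e i \<in> I" if "i < n" for i
    using bij_betwE[OF e] that by auto
  define M where "M = mat n n (\<lambda>(i,j). C (e i) (e j))"
  define w where "w = vec n (\<lambda>i. v (e i))"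
  have M: "M \<in> carrier_mat n n" and w: "w \<in> carrier_vec n"
    by (auto simp: M_def w_def)
  have "M *\<^sub>v w = z \<cdot>\<^sub>v w"
  proof (rule eq_vecI)
    fix i assume "i < dim_vec (z \<cdot>\<^sub>v w)"
    hence i: "i < n" by (simp add: w_def)
    have "(M *\<^sub>v w) $ i = (\<Sum>j<n. C (e i) (e j) * v (e j))"
      using i by (simp add: M_def w_def scalar_prod_def atLeast0LessThan)
    also have "\<dots> = (\<Sum>j\<in>I. C (e i) j * v j)"
      by (rule sum.reindex_bij_betw[OF e])
    also have "\<dots> = z * v (e i)"
      using ev[OF eI[OF i]] by simp
    finally show "(M *\<^sub>v w) $ i = (z \<cdot>\<^sub>v w) $ i"
      using i by (simp add: w_def)
  qed (simp_all add: M_def w_def)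
  moreover have "w \<noteq> 0\<^sub>v n"
  proof
    assume 0: "w = 0\<^sub>v n"
    obtain i where i: "i < n" "e i = i0"
      using nz(1) e by (auto simp: bij_betw_def)
    have "w $ i = 0" using 0 i by simp
    with i nz(2) show False by (simp add: w_def)
  qed
  ultimately have "eigenvalue M z"
    unfolding eigenvalue_def eigenvector_def using M w by auto
  hence root: "poly (char_poly M) z = 0"
    using eigenvalue_root_char_poly[OF M] by simp
  have "char_poly M \<in> polys_over A"
  proof -
    have carr: "char_poly_matrix M \<in> carrier_mat n n"
      using M by simp
    have ent: "char_poly_matrix M $$ (i, j) \<in> polys_over A" if "i < n" "j < n" for i j
      using that C[OF eI eI, of i j] is_subringD[OF A]
      by (auto simp: char_poly_matrix_def M_def intro!: polys_over_closed[OF A])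
    have sgn: "(signof q :: 'a poly) \<in> polys_over A" for q :: "nat \<Rightarrow> nat"
      using polys_over_closed(4)[OF A polys_over_closed(1)[OF A] polys_over_closed(2)[OF A]] polys_over_closed(2)[OF A]
      by (auto simp: sign_def)
    have sums: "(\<Sum>x\<in>S. f x) \<in> polys_over A" if "\<And>x. x \<in> S \<Longrightarrow> f x \<in> polys_over A" for f :: "(nat \<Rightarrow> nat) \<Rightarrow> 'a poly" and S
      using that by (induction S rule: infinite_finite_induct) (auto intro: polys_over_closed[OF A])
    show ?thesis
      unfolding char_poly_def det_def'[OF carr]
      by (intro sums polys_over_closed(5)[OF A] sgn polys_over_prod[OF A] ent)
        (auto simp: permutes_in_image)
  qed
  moreover have "lead_coeff (char_poly M) = 1"
    using degree_monic_char_poly[OF M] by auto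
  ultimately show ?thesis
    using root unfolding integral_closure_iff by blast
qed

text \<open>\<open>C\<close> is the companion matrix of a monic equation of \<open>x\<close>: every
  row but the last shifts the powers, and the last row rewrites \<open>x ^ m\<close>.\<close>

lemma integral_power_basis:
  assumes A: "is_subring A" and x: "x \<in> integral_closure A"
  obtains m C where "m > 0" "\<And>i j. i < m \<Longrightarrow> j < m \<Longrightarrow> C i j \<in> A"
    "\<And>i. i < m \<Longrightarrow> x * x ^ i = (\<Sum>j<m. C i j * x ^ j)"
proof -
  obtain f where f: "f \<in> polys_over A" "lead_coeff f = 1" "poly f x = 0"
    using x by (auto simp: integral_closure_iff)
  define m where "m = degree f"
  define C where "C i j = (if Suc i < m then (if j = Suc i then 1 else 0) else - coeff f j)" for i j
  have m: "m > 0"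
    using f by (cases "degree f = 0") (auto simp: m_def elim!: degree_eq_zeroE)
  have "x ^ m = (\<Sum>j<m. - coeff f j * x ^ j)"
    using f(2,3) by (simp add: poly_altdef m_def lessThan_Suc_atMost [symmetric] sum_negf eq_neg_iff_add_eq_0 add.commute)
  hence "x * x ^ i = (\<Sum>j<m. C i j * x ^ j)" if "i < m" for i
  proof (cases "Suc i < m")
    case True
    have "(\<Sum>j<m. C i j * x ^ j) = (\<Sum>j<m. if j = Suc i then x ^ j else 0)"
      by (rule sum.cong) (auto simp: C_def True)
    with True show ?thesis by simp
  next
    case False
    with that have m: "m = Suc i" by simp
    have "(\<Sum>j<m. C i j * x ^ j) = (\<Sum>j<m. - coeff f j * x ^ j)"
      by (rule sum.cong) (simp_all add: C_def False)
    with \<open>x ^ m = _\<close> show ?thesis by (simp add: m)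
  qed
  moreover have "C i j \<in> A" for i j
    using is_subringD[OF A] polys_overD[OF f(1)] by (auto simp: C_def)
  ultimately show thesis
    using m that by blast
qed

text \<open>The finitely many products \<open>x ^ i * y ^ j\<close> span an \<open>A\<close>-module
  stable under \<open>x\<close> and \<open>y\<close>. In tensor notation the matrices used are
  \<open>E = C \<otimes> 1\<close>, \<open>F = 1 \<otimes> D\<close> and
  \<open>G = C \<otimes> D\<close>.\<close>

lemma integral_closure_subring:
  assumes A: "is_subring A"
  shows "is_subring (integral_closure A)" "A \<subseteq> integral_closure A"
proof -
  note AA = is_subringD[OF A]
  show sub: "A \<subseteq> integral_closure A"
  proof
    fix a assume a: "a \<in> A"
    have "[:-a, 1:] \<in> polys_over A"
      by (intro polys_over_closed[OF A] AA a)
    then show "a \<in> integral_closure A"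
      unfolding integral_closure_iff by (intro bexI[of _ "[:-a, 1:]"]) auto
  qed
  have "x + y \<in> integral_closure A \<and> x - y \<in> integral_closure A \<and> x * y \<in> integral_closure A"
    if x: "x \<in> integral_closure A" and y: "y \<in> integral_closure A" for x y
  proof -
    obtain m C where C: "m > 0" "\<And>i j. i < m \<Longrightarrow> j < m \<Longrightarrow> C i j \<in> A"
      "\<And>i. i < m \<Longrightarrow> x * x ^ i = (\<Sum>j<m. C i j * x ^ j)"
      using integral_power_basis[OF A x] by blast
    obtain n D where D: "n > 0" "\<And>i j. i < n \<Longrightarrow> j < n \<Longrightarrow> D i j \<in> A"
      "\<And>i. i < n \<Longrightarrow> y * y ^ i = (\<Sum>j<n. D i j * y ^ j)"
      using integral_power_basis[OF A y] by blast
    define I where "I = {..<m} \<times> {..<n}"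
    define v where "v = (\<lambda>(i, j). x ^ i * y ^ j)"
    define E where "E = (\<lambda>(i::nat, j::nat) (i'::nat, j'::nat). if j' = j then C i i' else 0)"
    define F where "F = (\<lambda>(i::nat, j::nat) (i'::nat, j'::nat). if i' = i then D j j' else 0)"
    define G where "G = (\<lambda>(i::nat, j::nat) (i'::nat, j'::nat). C i i' * D j j')"
    have I: "finite I" "(0, 0) \<in> I" "v (0, 0) \<noteq> 0"
      using C(1) D(1) by (auto simp: I_def v_def)
    have inA: "E k l \<in> A" "F k l \<in> A" "G k l \<in> A" if "k \<in> I" "l \<in> I" for k l
      using that C(2) D(2) AA by (auto simp: E_def F_def G_def I_def)
    have ev: "x * v k = (\<Sum>l\<in>I. E k l * v l)" "y * v k = (\<Sum>l\<in>I. F k l * v l)"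
        "x * y * v k = (\<Sum>l\<in>I. G k l * v l)" if k: "k \<in> I" for k
    proof -
      obtain i j where ij: "k = (i, j)" "i < m" "j < n"
        using k by (auto simp: I_def)
      have "(\<Sum>l\<in>I. E k l * v l) = (\<Sum>i'<m. \<Sum>j'<n. if j' = j then C i i' * x ^ i' * y ^ j' else 0)"
        unfolding I_def sum.cartesian_product by (rule sum.cong) (auto simp: E_def v_def ij)
      also have "\<dots> = x * x ^ i * y ^ j"
        using ij by (simp add: C(3) sum_distrib_right)
      finally show "x * v k = (\<Sum>l\<in>I. E k l * v l)"
        by (simp add: v_def ij)
      have "(\<Sum>l\<in>I. F k l * v l) = (\<Sum>i'<m. \<Sum>j'<n. if i' = i then D j j' * x ^ i * y ^ j' else 0)"
        unfolding I_def sum.cartesian_product by (rule sum.cong) (auto simp: F_def v_def ij)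
      also have "\<dots> = (\<Sum>j'<n. \<Sum>i'<m. if i' = i then D j j' * x ^ i * y ^ j' else 0)"
        by (rule sum.swap)
      also have "\<dots> = x ^ i * (y * y ^ j)"
        using ij by (simp add: D(3) sum_distrib_left mult_ac)
      finally show "y * v k = (\<Sum>l\<in>I. F k l * v l)"
        by (simp add: v_def ij mult_ac)
      have "(\<Sum>l\<in>I. G k l * v l) = (\<Sum>i'<m. \<Sum>j'<n. (C i i' * x ^ i') * (D j j' * y ^ j'))"
        unfolding I_def sum.cartesian_product by (rule sum.cong) (auto simp: G_def v_def ij)
      also have "\<dots> = (x * x ^ i) * (y * y ^ j)"
        using ij by (simp add: C(3) D(3) sum_product)
      finally show "x * y * v k = (\<Sum>l\<in>I. G k l * v l)"
        by (simp add: v_def ij mult_ac)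
    qed
    have "x + y \<in> integral_closure A"
      by (rule integral_closureI_matrix[where v = v and C = "\<lambda>k l. E k l + F k l", OF A I(1) _ _ I(2) I(3)])
        (auto simp: algebra_simps ev sum.distrib intro: inA AA)
    moreover have "x - y \<in> integral_closure A"
      by (rule integral_closureI_matrix[where v = v and C = "\<lambda>k l. E k l - F k l", OF A I(1) _ _ I(2) I(3)])
        (auto simp: algebra_simps ev sum_subtractf intro: inA AA)
    moreover have "x * y \<in> integral_closure A"
      by (rule integral_closureI_matrix[where v = v and C = G, OF A I(1) _ _ I(2) I(3)])
        (auto simp: ev intro: inA)
    ultimately show ?thesis by blast
  qed
  moreover have "0 \<in> integral_closure A" "1 \<in> integral_closure A"
    using AA sub by auto
  ultimately show "is_subring (integral_closure A)"
    unfolding is_subring_def by blast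
qed

section \<open>Artin--Schreier polynomials and extensions\<close>

lemma of_nat_power_char:
  assumes "prime p" "CHAR('a::field) = p"
  shows "(of_nat n :: 'a) ^ p = of_nat n"
proof (induction n)
  case 0
  then show ?case using assms(1) by (simp add: prime_gt_0_nat power_0_left)
next
  case (Suc n)
  have "(1 + of_nat n :: 'a) ^ p = 1 ^ p + of_nat n ^ p"
    by (rule freshmans_dream) (use assms in auto)
  then show ?case using Suc by simp
qed

lemma inj_on_of_nat_char:
  assumes "CHAR('a::field) = p"
  shows "inj_on (of_nat :: nat \<Rightarrow> 'a) {..<p}"
  using assms by (auto intro!: inj_onI simp: of_nat_eq_iff_cong_CHAR cong_def)

definition wp_poly :: "nat \<Rightarrow> 'a::comm_ring_1 poly" where
  "wp_poly p = monom 1 p - [:0, 1:]"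

lemma poly_wp_poly [simp]: "poly (wp_poly p) x = x ^ p - x"
  by (simp add: wp_poly_def poly_monom)

lemma wp_poly_degree:
  assumes "p > 1"
  shows "degree (wp_poly p :: 'a::field poly) = p" "lead_coeff (wp_poly p :: 'a poly) = 1"
proof -
  show deg: "degree (wp_poly p :: 'a poly) = p"
    unfolding wp_poly_def by (subst diff_conv_add_uminus, subst degree_add_eq_left)
      (use assms in \<open>auto simp: degree_monom_eq\<close>)
  show "lead_coeff (wp_poly p :: 'a poly) = 1"
    unfolding deg using assms by (simp add: wp_poly_def coeff_pCons coeff_eq_0 split: nat.splits)
qed

text \<open>Both sides have degree \<open>p\<close>, are monic, and vanish on the \<open>p\<close>
  elements of the prime field.\<close>

lemma prod_linear_of_nat:
  assumes p: "prime p" "CHAR('a::field) = p"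
  shows "(\<Prod>i<p. [:of_nat i, 1 :: 'a:]) = wp_poly p" (is "?f = ?g")
proof (rule poly_eqI_degree_lead_coeff[where n = p and A = "(\<lambda>i. - of_nat i) ` {..<p}"])
  have p1: "p > 1" using p(1) by (rule prime_gt_1_nat)
  have deg: "degree ?f = p"
    by (subst degree_prod_eq_sum_degree) auto
  have "lead_coeff ?f = 1"
    by (simp add: lead_coeff_prod)
  hence "coeff ?f p = 1" by (simp only: deg)
  then show "coeff ?f p = coeff ?g p" using wp_poly_degree[OF p1, where 'a = 'a] by simp
  show "degree ?f \<le> p" "degree ?g \<le> p"
    using deg wp_poly_degree[OF p1, where 'a = 'a] by auto
  show "p \<le> card ((\<lambda>i. - of_nat i :: 'a) ` {..<p})"
    using inj_on_of_nat_char[OF p(2)] by (subst card_image) (auto simp: inj_on_def)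
  fix z :: 'a assume "z \<in> (\<lambda>i. - of_nat i) ` {..<p}"
  then obtain i where i: "i < p" "z = - of_nat i" by auto
  have "- of_nat i = (of_nat (p - 1) * of_nat i :: 'a)"
    using p(2) of_nat_CHAR[where 'a = 'a] p1 by (simp add: of_nat_diff)
  hence z: "z = of_nat ((p - 1) * i)" using i by simp
  have "z ^ p = z"
    unfolding z by (rule of_nat_power_char[OF p])
  moreover have "(\<Prod>j<p. of_nat j + z) = 0"
    using i by (auto simp: prod_zero_iff)
  ultimately show "poly ?f z = poly ?g z"
    by (simp add: poly_prod)
qed

lemma prod_add_of_nat:
  assumes p: "prime p" "CHAR('a::field) = p"
  shows "(\<Prod>i<p. x + of_nat i :: 'a) = x ^ p - x"
  using arg_cong[OF prod_linear_of_nat[OF p], of "\<lambda>f. poly f x"]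
  by (simp add: poly_prod add.commute)

text \<open>The difference \<open>x - y\<close> is fixed by Frobenius, so the product formula forces
  it into the prime field.\<close>

lemma AS_roots:
  assumes p: "prime p" "CHAR('a::field) = p"
  shows "(y::'a) ^ p - y = x ^ p - x \<longleftrightarrow> (\<exists>i<p. y = x + of_nat i)"
proof
  assume eq: "y ^ p - y = x ^ p - x"
  have fd: "(y - x + x) ^ p = (y - x) ^ p + x ^ p"
    by (rule freshmans_dream) (use p in auto)
  \<comment> \<open>The sum in brackets is zero; this gives
    \<open>(x - y) ^ p = - ((y - x) ^ p)\<close> for \<open>p = 2\<close> and odd \<open>p\<close>
    alike.\<close>
  have "(x - y + (y - x)) ^ p = (x - y) ^ p + (y - x) ^ p"
    by (rule freshmans_dream) (use p in auto)
  hence "(x - y) ^ p = - ((y - x) ^ p)"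
    using prime_gt_0_nat[OF p(1)] by (simp add: power_0_left eq_neg_iff_add_eq_0)
  also have "\<dots> = x ^ p - y ^ p" using fd by simp
  also have "\<dots> = x - y" using eq by (simp add: algebra_simps)
  finally have "(\<Prod>i<p. (x - y) + of_nat i) = 0"
    by (simp add: prod_add_of_nat[OF p])
  then obtain i where "i < p" "(x - y) + of_nat i = 0"
    by (auto simp: prod_zero_iff)
  thus "\<exists>i<p. y = x + of_nat i"
    by (intro exI[of _ i]) (auto simp: algebra_simps)
next
  assume "\<exists>i<p. y = x + of_nat i"
  then obtain i where y: "y = x + of_nat i" by auto
  have "y ^ p = x ^ p + of_nat i ^ p"
    unfolding y by (rule freshmans_dream) (use p in auto)
  hence "y ^ p = x ^ p + of_nat i"
    by (simp only: of_nat_power_char[OF p])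
  thus "y ^ p - y = x ^ p - x" by (simp add: y)
qed

text \<open>Vieta's formula for the sum of the roots; the leading coefficient and the degree are
  included because the induction needs them.\<close>

lemma coeff_prod_linear:
  fixes S :: "'a::field set"
  assumes "finite S"
  shows "coeff (\<Prod>a\<in>S. [:-a, 1:]) (card S) = 1 \<and> degree (\<Prod>a\<in>S. [:-a, 1:]) = card S \<and>
    (\<forall>n. card S = Suc n \<longrightarrow> coeff (\<Prod>a\<in>S. [:-a, 1:]) n = - (\<Sum>S))"
  using assms
proof (induction S rule: finite_induct)
  case (insert a T)
  let ?P = "\<Prod>b\<in>T. [:-b, 1:]"
  have *: "(\<Prod>b\<in>insert a T. [:-b, 1:]) = smult (- a) ?P + pCons 0 ?P"
    using insert by simp
  have deg: "degree (\<Prod>b\<in>insert a T. [:-b, 1:]) = card (insert a T)"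
    using insert by (subst degree_prod_eq_sum_degree) auto
  have "coeff (\<Prod>b\<in>insert a T. [:-b, 1:]) (card T) = - (\<Sum>(insert a T))"
  proof (cases "card T")
    case 0
    then have "T = {}" using insert by simp
    then show ?thesis by simp
  next
    case (Suc n)
    then show ?thesis using insert unfolding * by simp
  qed
  moreover have "coeff (\<Prod>b\<in>insert a T. [:-b, 1:]) (card (insert a T)) = 1"
    using insert unfolding * by (simp add: coeff_eq_0)
  ultimately show ?case using deg insert by simp
qed simp

text \<open>A polynomial \<open>T\<^sup>p - T - h\<close> over \<open>K\<close> that has a factor of degree \<open>0 < d < p\<close> has a
  root in \<open>K\<close>: the roots of the factor are of the form \<open>\<eta> + i\<close>, so their sum has the form
  \<open>d \<eta> + n\<close>.\<close>

lemma AS_root_in_subfield: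
  fixes K :: "'a::field set"
  assumes p: "prime p" "CHAR('a) = p" and K: "is_subfield K"
    and \<eta>: "\<eta> ^ p - \<eta> \<in> K"
    and g: "g \<in> polys_over K" "g \<noteq> 0" "degree g < p" "poly g \<eta> = 0"
  shows "\<eta> \<in> K"
proof -
  note K' = is_subfield_imp_subring[OF K]
  note KK = is_subringD[OF K'] is_subfieldD[OF K]
  have p1: "p > 1" using p(1) by (rule prime_gt_1_nat)
  \<comment> \<open>The monic multiple \<open>m\<close> of \<open>f\<close> is the minimal
    polynomial of \<open>\<eta>\<close> over \<open>K\<close>, and so divides
    \<open>F\<close>.\<close>
  obtain f where f: "f \<in> polys_over K" "f \<noteq> 0" "poly f \<eta> = 0"
    and min: "\<And>g. g \<in> polys_over K \<Longrightarrow> g \<noteq> 0 \<Longrightarrow> poly g \<eta> = 0 \<Longrightarrow> degree f \<le> degree g"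
    using ex_has_least_nat[of "\<lambda>f. f \<in> polys_over K \<and> f \<noteq> 0 \<and> poly f \<eta> = 0" g degree] g
    by blast
  define m where "m = smult (inverse (lead_coeff f)) f"
  have m: "m \<in> polys_over K" "lead_coeff m = 1" "poly m \<eta> = 0" "degree m = degree f" "m \<noteq> 0"
    using f by (auto simp: m_def intro!: polys_over_closed[OF K'] KK polys_overD)
  define d where "d = degree m"
  have d: "d < p" "d > 0"
    using min[OF g(1,2,4)] g(3) m
    by (auto simp: d_def intro!: Nat.gr0I elim!: degree_eq_zeroE)
  define F where "F = monom 1 p - [:\<eta> ^ p - \<eta>, 1:]"
  have F: "F \<in> polys_over K"
    unfolding F_def by (intro polys_over_closed[OF K'] KK \<eta>)
  have degF: "degree F = p"
    unfolding F_def by (subst diff_conv_add_uminus, subst degree_add_eq_left)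
      (use p1 in \<open>auto simp: degree_monom_eq\<close>)
  have polyF: "poly F x = x ^ p - x - (\<eta> ^ p - \<eta>)" for x
    by (simp add: F_def poly_monom)
  obtain q r where qr: "q \<in> polys_over K" "r \<in> polys_over K" "F = m * q + r"
      "r = 0 \<or> degree r < degree m"
    using polys_over_divmod_monic[OF K' m(1,2) F] by blast
  have "poly r \<eta> = 0"
    using qr(3) m(3) polyF[of \<eta>] by simp
  hence "r = 0"
    using min[OF qr(2)] qr(4) m(4) by linarith
  hence Fmq: "F = m * q" using qr by simp
  have q0: "q \<noteq> 0" using degF p1 Fmq by auto
  define R where "R = (\<lambda>i. \<eta> + of_nat i) ` {..<p}"
  have cardR: "card R = p"
    unfolding R_def using inj_on_of_nat_char[OF p(2)] by (subst card_image) (auto simp: inj_on_def)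
  define S where "S = {a\<in>R. poly m a = 0}"
  have finR: "finite R" by (simp add: R_def)
  have "poly F a = 0" if "a \<in> R" for a
    using that AS_roots[OF p, of a \<eta>] by (auto simp: polyF R_def)
  \<comment> \<open>Counting roots: \<open>F\<close> has \<open>p\<close> of them and
    \<open>q\<close> at most \<open>p - d\<close>, so \<open>m\<close> has \<open>d\<close> distinct
    roots among the \<open>\<eta> + i\<close> and splits completely.\<close>
  hence "R \<subseteq> S \<union> {a. poly q a = 0}"
    by (auto simp: S_def Fmq)
  hence "p \<le> card (S \<union> {a. poly q a = 0})"
    unfolding cardR [symmetric] using finR q0 by (intro card_mono) (auto simp: S_def poly_roots_finite)
  also have "\<dots> \<le> card S + degree q"
    using card_Un_le[of S "{a. poly q a = 0}"] card_poly_roots_bound[OF q0] by linarith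
  also have "degree q = p - d"
    using degF q0 m(5) by (simp add: Fmq degree_mult_eq d_def)
  finally have "d \<le> card S" using d by simp
  moreover have "card S \<le> d"
  proof -
    have "card S \<le> card {a. poly m a = 0}"
      using m(5) by (intro card_mono) (auto simp: S_def poly_roots_finite)
    with card_poly_roots_bound[OF m(5)] show ?thesis by (simp add: d_def)
  qed
  ultimately have cardS: "card S = d" by simp
  have finS: "finite S" using finR by (simp add: S_def)
  note lin = coeff_prod_linear[OF finS]
  have mS: "m = (\<Prod>a\<in>S. [:-a, 1:])"
    by (rule poly_eqI_degree_lead_coeff[where n = d and A = S])
      (use lin cardS m(2) finS in \<open>auto simp: d_def S_def poly_prod prod_zero_iff\<close>)
  obtain n where n: "d = Suc n" using d by (cases d) auto
  have "(\<Sum>S) = - coeff m n"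
    unfolding mS using lin n cardS by simp
  hence sumK: "(\<Sum>S) \<in> K"
    using polys_overD[OF m(1)] KK by auto
  have "\<forall>a\<in>S. \<exists>i. a = \<eta> + of_nat i" by (auto simp: S_def R_def)
  then obtain i where i: "\<And>a. a \<in> S \<Longrightarrow> a = \<eta> + of_nat (i a)" by metis
  have "(\<Sum>S) = (\<Sum>a\<in>S. \<eta> + of_nat (i a))"
    by (rule sum.cong) (use i in auto)
  also have "\<dots> = of_nat d * \<eta> + of_nat (\<Sum>a\<in>S. i a)"
    by (simp add: sum.distrib cardS)
  finally have "of_nat d * \<eta> = (\<Sum>S) - of_nat (\<Sum>a\<in>S. i a)" by simp
  hence *: "of_nat d * \<eta> \<in> K"
    using KK(4)[OF sumK subring_of_nat[OF K']] by (simp del: of_nat_sum)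
  have nz: "of_nat d \<noteq> (0::'a)"
    using d p(2) by (auto simp: of_nat_eq_0_iff_char_dvd dest: nat_dvd_not_less)
  have "of_nat d * \<eta> / of_nat d \<in> K"
    by (rule KK(8)[OF * subring_of_nat[OF K']])
  thus ?thesis using nz by simp
qed

locale AS_element =
  fixes p :: nat and K :: "'a::field set" and \<theta> :: 'a
  assumes p: "prime p" "CHAR('a) = p" and K: "is_subfield K"
    and \<theta>: "\<theta> ^ p - \<theta> \<in> K" "\<theta> \<notin> K"
begin

lemmas Kr = is_subfield_imp_subring[OF K]
lemmas K_simps = is_subringD[OF Kr] is_subfieldD[OF K] subring_power[OF Kr] subring_of_nat[OF Kr]
lemmas polys_K = polys_over_closed[OF Kr]

lemma p_gt: "p > 1" "p > 0"
  using prime_gt_1_nat[OF p(1)] by auto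

lemma of_nat_p: "of_nat p = (0::'a)"
  using of_nat_CHAR[where 'a = 'a] p(2) by simp

definition as_poly :: "'a poly" where
  "as_poly = monom 1 p - [:\<theta> ^ p - \<theta>, 1:]"

lemma as_poly: "as_poly \<in> polys_over K" "degree as_poly = p" "lead_coeff as_poly = 1"
  "poly as_poly x = x ^ p - x - (\<theta> ^ p - \<theta>)" "as_poly \<noteq> 0"
proof -
  show "as_poly \<in> polys_over K"
    unfolding as_poly_def by (intro polys_K K_simps \<theta>)
  show deg: "degree as_poly = p"
    unfolding as_poly_def by (subst diff_conv_add_uminus, subst degree_add_eq_left)
      (use p_gt in \<open>auto simp: degree_monom_eq\<close>)
  show "lead_coeff as_poly = 1"
    unfolding deg using p_gt by (simp add: as_poly_def coeff_pCons coeff_eq_0 split: nat.splits)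
  show "poly as_poly x = x ^ p - x - (\<theta> ^ p - \<theta>)"
    by (simp add: as_poly_def poly_monom)
  show "as_poly \<noteq> 0" using deg p_gt by auto
qed

text \<open>Stands in for the irreducibility of \<open>as_poly\<close>: the powers of \<theta> below
  the \<open>p\<close>-th are linearly independent over \<open>K\<close>.\<close>

lemma poly_nonzero:
  assumes "g \<in> polys_over K" "g \<noteq> 0" "degree g < p"
  shows "poly g \<theta> \<noteq> 0"
  using AS_root_in_subfield[OF p K \<theta>(1) assms] \<theta>(2) by blast

lemma poly_reduce:
  assumes f: "f \<in> polys_over K"
  obtains q r where "q \<in> polys_over K" "r \<in> polys_over K" "f = as_poly * q + r" "degree r < p"
    "poly r \<theta> = poly f \<theta>"
proof -
  obtain q r where "q \<in> polys_over K" "r \<in> polys_over K" "f = as_poly * q + r"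
    "r = 0 \<or> degree r < degree as_poly"
    using polys_over_divmod_monic[OF Kr as_poly(1,3) f] by blast
  then show thesis
    using p_gt by (intro that[of q r]) (auto simp: as_poly)
qed

text \<open>The Euclidean algorithm: dividing \<open>as_poly\<close> by \<open>g\<close> shows that
  a multiple of \<open>g(\<theta>)\<close> is the value at \<theta> of a remainder of smaller
  degree, which is invertible by induction.\<close>

lemma inverse_poly:
  assumes "g \<in> polys_over K" "g \<noteq> 0" "degree g < p"
  shows "\<exists>q\<in>polys_over K. poly q \<theta> * poly g \<theta> = 1"
  using assms
proof (induction "degree g" arbitrary: g rule: less_induct)
  case (less g)
  have gnz: "poly g \<theta> \<noteq> 0"
    by (rule poly_nonzero) (use less.prems in auto)
  define m where "m = smult (inverse (lead_coeff g)) g"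
  have lc: "inverse (lead_coeff g) \<in> K"
    using less.prems by (intro K_simps polys_overD)
  have m: "m \<in> polys_over K" "lead_coeff m = 1" "degree m = degree g"
    using less.prems lc by (auto simp: m_def intro!: polys_K)
  have polym: "poly m \<theta> = inverse (lead_coeff g) * poly g \<theta>" by (simp add: m_def)
  obtain q r where qr: "q \<in> polys_over K" "r \<in> polys_over K" "as_poly = m * q + r"
      "r = 0 \<or> degree r < degree m"
    using polys_over_divmod_monic[OF Kr m(1,2) as_poly(1)] by blast
  have qr0: "poly m \<theta> * poly q \<theta> = - poly r \<theta>"
    using arg_cong[OF qr(3), of "\<lambda>f. poly f \<theta>"] by (simp add: as_poly eq_neg_iff_add_eq_0)
  show ?case
  proof (cases "degree g = 0")
    case True
    then obtain c where c: "g = [:c:]" by (auto elim!: degree_eq_zeroE)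
    have "[:inverse c:] \<in> polys_over K"
      using lc c by (intro polys_K) auto
    moreover have "c \<noteq> 0" using c less.prems by auto
    ultimately show ?thesis by (intro bexI[of _ "[:inverse c:]"]) (auto simp: c)
  next
    case False
    \<comment> \<open>Otherwise \<open>as_poly\<close> would be a product of two polynomials of
      degree below \<open>p\<close>, neither of which vanishes at \<theta>.\<close>
    have "r \<noteq> 0"
    proof
      assume "r = 0"
      hence *: "as_poly = m * q" using qr by simp
      hence "q \<noteq> 0" using as_poly by auto
      have "degree q < p"
        using arg_cong[OF *, of degree] \<open>q \<noteq> 0\<close> m less.prems False as_poly(2)
        by (subst (asm) degree_mult_eq) auto
      hence "poly q \<theta> \<noteq> 0" using poly_nonzero[OF qr(1) \<open>q \<noteq> 0\<close>] by simp
      moreover have "poly m \<theta> \<noteq> 0" using gnz less.prems by (simp add: polym)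
      ultimately show False using qr0 \<open>r = 0\<close> by simp
    qed
    then obtain q' where q': "q' \<in> polys_over K" "poly q' \<theta> * poly r \<theta> = 1"
      using less.hyps[of r] qr m less.prems by auto
    show ?thesis
    proof (intro bexI[of _ "smult (- inverse (lead_coeff g)) (q * q')"])
      have "poly (smult (- inverse (lead_coeff g)) (q * q')) \<theta> * poly g \<theta>
          = - (poly m \<theta> * poly q \<theta>) * poly q' \<theta>"
        by (simp add: polym mult_ac)
      also have "\<dots> = 1" using q' by (simp add: qr0 mult_ac)
      finally show "poly (smult (- inverse (lead_coeff g)) (q * q')) \<theta> * poly g \<theta> = 1" .
    qed (intro polys_K qr q' K_simps(6) lc)
  qed
qed

lemma subfield_polys: "is_subfield ((\<lambda>g. poly g \<theta>) ` polys_over K)" (is "is_subfield ?F")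
proof -
  have "poly f \<theta> + poly g \<theta> \<in> ?F" "poly f \<theta> - poly g \<theta> \<in> ?F" "poly f \<theta> * poly g \<theta> \<in> ?F"
    if "f \<in> polys_over K" "g \<in> polys_over K" for f g
    using polys_K(3-5)[OF that] by (metis image_eqI poly_add poly_diff poly_mult)+
  moreover have "0 \<in> ?F" "1 \<in> ?F"
    using polys_K(1,2) by (metis image_eqI poly_0 poly_1)+
  moreover have "inverse (poly f \<theta>) \<in> ?F" if f: "f \<in> polys_over K" for f
  proof (cases "poly f \<theta> = 0")
    case True
    then show ?thesis using \<open>0 \<in> ?F\<close> by simp
  next
    case False
    obtain q r where r: "r \<in> polys_over K" "degree r < p" "poly r \<theta> = poly f \<theta>"
      using poly_reduce[OF f] by blast
    then obtain q' where "q' \<in> polys_over K" "poly q' \<theta> * poly r \<theta> = 1"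
      using inverse_poly[of r] False by force
    hence "inverse (poly f \<theta>) = poly q' \<theta>"
      using r(3) False by (simp add: field_simps)
    thus ?thesis using \<open>q' \<in> _\<close> by blast
  qed
  ultimately show ?thesis unfolding is_subfield_def by blast
qed

end

text \<open>This says \<open>L = K(\<theta>)\<close>, where \<open>L\<close> is the whole type: by
  \<open>subfield_polys\<close> the polynomial expressions in \<theta> already form a field.\<close>

locale AS_extension = AS_element +
  assumes gen: "\<exists>g\<in>polys_over K. poly g \<theta> = x"
begin

lemma rep: obtains g where "g \<in> polys_over K" "degree g < p" "poly g \<theta> = x"
proof -
  obtain g where g: "g \<in> polys_over K" "poly g \<theta> = x" using gen by blast
  then show thesis using poly_reduce[OF g(1)] that by metis
qed

text \<open>The remainder of \<open>f\<close> modulo \<open>as_poly\<close> is zero. Hence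
  substituting another root for \<theta> does not depend on the polynomial that represents an
  element.\<close>

lemma poly_translate_eq:
  assumes f: "f \<in> polys_over K" "poly f \<theta> = 0" and \<eta>: "\<eta> ^ p - \<eta> = \<theta> ^ p - \<theta>"
  shows "poly f \<eta> = 0"
proof -
  obtain q r where qr: "q \<in> polys_over K" "r \<in> polys_over K" "f = as_poly * q + r" "degree r < p"
    "poly r \<theta> = poly f \<theta>"
    using poly_reduce[OF f(1)] by blast
  have "r = 0" using poly_nonzero[OF qr(2) _ qr(4)] qr(5) f(2) by auto
  thus ?thesis using qr(3) \<eta> by (simp add: as_poly)
qed

lemma exists_translation: "\<exists>\<tau>\<in>Gal K. \<tau> \<theta> = \<theta> + 1"
proof -
  \<comment> \<open>The automorphism sends \<open>f(\<theta>)\<close> to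
    \<open>f(\<theta> + 1)\<close>; \<open>rp\<close> picks some representing polynomial, and
    \<open>poly_translate_eq\<close> shows that the choice is immaterial.\<close>
  define rp where "rp x = (SOME g. g \<in> polys_over K \<and> poly g \<theta> = x)" for x
  have rp: "rp x \<in> polys_over K" "poly (rp x) \<theta> = x" for x
    using someI_ex[of "\<lambda>g. g \<in> polys_over K \<and> poly g \<theta> = x"] gen[of x] by (auto simp: rp_def)
  have root: "(\<theta> + 1) ^ p - (\<theta> + 1) = \<theta> ^ p - \<theta>"
    using AS_roots[OF p, of "\<theta> + 1" \<theta>] p_gt by (metis of_nat_1)
  define \<tau> where "\<tau> x = poly (rp x) (\<theta> + 1)" for x
  have \<tau>: "\<tau> (poly f \<theta>) = poly f (\<theta> + 1)" if "f \<in> polys_over K" for f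
  proof -
    have "poly (rp (poly f \<theta>) - f) (\<theta> + 1) = 0"
      by (rule poly_translate_eq[OF polys_K(4)[OF rp(1) that] _ root]) (simp add: rp(2))
    thus ?thesis by (simp add: \<tau>_def)
  qed
  have add: "\<tau> (x + y) = \<tau> x + \<tau> y" and mult: "\<tau> (x * y) = \<tau> x * \<tau> y" for x y
    using \<tau>[OF polys_K(3)[OF rp(1) rp(1)], of x y] \<tau>[OF polys_K(5)[OF rp(1) rp(1)], of x y] rp(2)
    by (simp_all add: \<tau>_def)
  have const: "\<tau> c = c" if "c \<in> K" for c
    using \<tau>[of "[:c:]"] polys_K(7)[OF that polys_K(1)] by simp
  have \<theta>1: "\<tau> \<theta> = \<theta> + 1"
    using \<tau>[OF polys_K(7)[OF K_simps(1) polys_K(2)]] by simp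
  have \<tau>0: "\<tau> 0 = 0" "\<tau> 1 = 1" using const K_simps by auto
  have "inj \<tau>"
  proof (rule injI)
    fix x y assume "\<tau> x = \<tau> y"
    hence 0: "\<tau> (x - y) = 0" using add[of "x - y" y] by simp
    show "x = y"
    proof (rule ccontr)
      assume "x \<noteq> y"
      hence "\<tau> (x - y) * \<tau> (inverse (x - y)) = 1" using \<tau>0 by (simp add: mult [symmetric])
      with 0 show False by simp
    qed
  qed
  moreover have "surj \<tau>"
  proof (rule surjI)
    fix x
    have "pcompose (rp x) [:-1, 1:] \<in> polys_over K"
      by (intro polys_K rp K_simps)
    from \<tau>[OF this] show "\<tau> (poly (pcompose (rp x) [:-1, 1:]) \<theta>) = x"
      by (simp add: poly_pcompose rp)
  qed
  ultimately have "\<tau> \<in> Gal K"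
    using add mult const \<tau>0 by (simp add: Gal_def bij_def)
  thus ?thesis using \<theta>1 by blast
qed

end

text \<open>Some root lies outside \<open>K\<close>, since adjoining elements of \<open>K\<close>
  gives only \<open>K\<close>. The other roots differ from it by integers, so a single root
  generates the field.\<close>

lemma adjoin_AS_UNIV_D:
  fixes K :: "'a::field set"
  assumes p: "prime p" "CHAR('a) = p" and K: "is_subfield K" "K \<noteq> UNIV" and h: "h \<in> K"
    and ad: "adjoin K {\<theta>. \<theta> ^ p - \<theta> = h} = UNIV"
  obtains \<theta> where "\<theta> ^ p - \<theta> = h" "AS_extension p K \<theta>"
proof -
  have "\<not> {\<theta>. \<theta> ^ p - \<theta> = h} \<subseteq> K"
  proof
    assume "{\<theta>. \<theta> ^ p - \<theta> = h} \<subseteq> K"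
    hence "adjoin K {\<theta>. \<theta> ^ p - \<theta> = h} \<subseteq> K"
      unfolding adjoin_def using K(1) by blast
    with ad K(2) show False by blast
  qed
  then obtain \<theta> where root: "\<theta> ^ p - \<theta> = h" "\<theta> \<notin> K" by auto
  interpret AS_element p K \<theta>
    by standard (use p K root h in auto)
  let ?F = "(\<lambda>g. poly g \<theta>) ` polys_over K"
  have KF: "c \<in> ?F" if "c \<in> K" for c
    using polys_K(7)[OF that polys_K(1)] by (auto intro!: image_eqI[of _ _ "[:c:]"])
  have \<theta>F: "\<theta> \<in> ?F"
    using polys_K(7)[OF K_simps(1) polys_K(7)[OF K_simps(2) polys_K(1)]]
    by (auto intro!: image_eqI[of _ _ "[:0,1:]"])
  have *: "\<eta> \<in> ?F" if \<eta>: "\<eta> ^ p - \<eta> = h" for \<eta>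
  proof -
    obtain i where "\<eta> = \<theta> + of_nat i"
      using \<eta> AS_roots[OF p, of \<eta> \<theta>] root(1) by auto
    thus ?thesis
      using is_subringD(3)[OF is_subfield_imp_subring[OF subfield_polys] \<theta>F KF[OF K_simps(10)]] by simp
  qed
  have "adjoin K {\<theta>. \<theta> ^ p - \<theta> = h} \<subseteq> ?F"
    unfolding adjoin_def by (intro Inter_lower CollectI conjI subfield_polys; use KF * in blast)
  hence "x \<in> ?F" for x
    unfolding ad by (rule subsetD) simp
  hence "\<exists>g\<in>polys_over K. poly g \<theta> = x" for x
    by (metis imageE)
  hence "AS_extension p K \<theta>"
    by (intro AS_extension.intro AS_element_axioms AS_extension_axioms.intro)
  thus thesis by (rule that[OF root(1)])
qed

lemma adjoin_AS_UNIV_I: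
  assumes "AS_extension p K \<theta>" "\<theta> ^ p - \<theta> = h"
  shows "adjoin K {\<theta>. \<theta> ^ p - \<theta> = h} = UNIV"
proof -
  interpret AS_extension p K \<theta> by fact
  have "x \<in> F" if F: "is_subfield F" "K \<subseteq> F" "{\<theta>. \<theta> ^ p - \<theta> = h} \<subseteq> F" for x F
  proof -
    obtain g where g: "g \<in> polys_over K" "poly g \<theta> = x" using gen by blast
    have "\<theta> \<in> F" using F(3) assms(2) by blast
    hence "poly g \<theta> \<in> F"
      by (rule polys_over_closed(11)[OF is_subfield_imp_subring[OF F(1)] polys_over_mono[OF F(2) g(1)]])
    thus ?thesis using g by simp
  qed
  thus ?thesis unfolding adjoin_def by blast
qed

section \<open>Automorphisms of the extension and the norm\<close>

lemma Gal_hom: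
  assumes "\<tau> \<in> Gal K"
  shows "\<tau> (x + y) = \<tau> x + \<tau> y" "\<tau> (x * y) = \<tau> x * \<tau> y" "\<tau> 0 = 0" "\<tau> 1 = 1" "\<tau> (- x) = - \<tau> x"
    "\<tau> (x - y) = \<tau> x - \<tau> y" "\<tau> x = 0 \<longleftrightarrow> x = 0" "\<tau> (inverse x) = inverse (\<tau> x)" "\<tau> (x / y) = \<tau> x / \<tau> y"
    "\<tau> (x ^ n) = \<tau> x ^ n" "\<tau> (of_nat n) = of_nat n" "c \<in> K \<Longrightarrow> \<tau> c = c"
proof -
  have bij: "bij \<tau>" and add: "\<And>x y. \<tau> (x + y) = \<tau> x + \<tau> y" and mult: "\<And>x y. \<tau> (x * y) = \<tau> x * \<tau> y"
    and one: "\<tau> 1 = 1" and fixK: "\<And>x. x \<in> K \<Longrightarrow> \<tau> x = x"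
    using assms by (auto simp: Gal_def)
  show zero: "\<tau> 0 = 0" using add[of 0 0] by (metis add.right_neutral add_left_cancel)
  show minus: "\<tau> (- x) = - \<tau> x" for x
    using add[of x "- x"] zero by (simp add: eq_neg_iff_add_eq_0 add.commute)
  show "\<tau> (x - y) = \<tau> x - \<tau> y" using add[of x "- y"] minus[of y] by simp
  show nz: "\<tau> x = 0 \<longleftrightarrow> x = 0" for x using zero bij by (metis bij_def injD)
  show inv: "\<tau> (inverse x) = inverse (\<tau> x)" for x
  proof (cases "x = 0")
    case False
    then have "\<tau> x * \<tau> (inverse x) = 1" using mult[of x "inverse x"] one by simp
    then show ?thesis by (simp add: inverse_unique)
  qed (simp add: zero)
  show "\<tau> (x / y) = \<tau> x / \<tau> y" by (simp add: divide_inverse mult inv)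
  show "\<tau> (x ^ n) = \<tau> x ^ n" by (induction n) (simp_all add: one mult)
  show "\<tau> (of_nat n) = of_nat n" by (induction n) (simp_all add: zero add one)
qed (use assms in \<open>auto simp: Gal_def\<close>)

lemma Gal_sum: "\<tau> \<in> Gal K \<Longrightarrow> \<tau> (sum f I) = (\<Sum>i\<in>I. \<tau> (f i))"
  by (induction I rule: infinite_finite_induct) (auto simp: Gal_hom)

lemma Gal_prod: "\<tau> \<in> Gal K \<Longrightarrow> \<tau> (prod f I) = (\<Prod>i\<in>I. \<tau> (f i))"
  by (induction I rule: infinite_finite_induct) (auto simp: Gal_hom)

lemma Gal_funpow: "\<tau> \<in> Gal K \<Longrightarrow> \<tau> ^^ n \<in> Gal K"
proof (induction n)
  case 0
  then show ?case using bij_id by (auto simp: Gal_def id_def)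
next
  case (Suc n)
  then have "bij (\<tau> \<circ> \<tau> ^^ n)"
    by (intro bij_comp) (auto simp: Gal_def)
  then show ?case using Suc by (auto simp: Gal_def o_def)
qed

lemma Gal_map_poly_mult: "\<tau> \<in> Gal K \<Longrightarrow> map_poly \<tau> (f * g) = map_poly \<tau> f * map_poly \<tau> g"
  by (intro poly_eqI) (simp add: coeff_map_poly coeff_mult Gal_hom Gal_sum)

lemma Gal_map_poly_prod: "\<tau> \<in> Gal K \<Longrightarrow> map_poly \<tau> (prod f I) = (\<Prod>i\<in>I. map_poly \<tau> (f i))"
  by (induction I rule: infinite_finite_induct) (auto simp: Gal_map_poly_mult Gal_hom)

lemma Gal_poly: "\<tau> \<in> Gal K \<Longrightarrow> \<tau> (poly f x) = poly (map_poly \<tau> f) (\<tau> x)"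
  by (induction f) (auto simp: Gal_hom map_poly_pCons)

lemma Gal_poly_K:
  assumes "\<tau> \<in> Gal K" "f \<in> polys_over K"
  shows "\<tau> (poly f x) = poly f (\<tau> x)"
proof -
  have "map_poly \<tau> f = f"
    using assms by (intro poly_eqI) (auto simp: coeff_map_poly Gal_hom polys_overD)
  thus ?thesis using Gal_poly[OF assms(1), of f x] by simp
qed

lemma Gal_map_poly_lead_coeff: "\<tau> \<in> Gal K \<Longrightarrow> lead_coeff (map_poly \<tau> f) = \<tau> (lead_coeff f)"
  by (cases "f = 0") (auto simp: Gal_hom lead_coeff_map_poly_nz)

lemma (in AS_extension) Gal_root:
  assumes "\<tau> \<in> Gal K"
  obtains i where "i < p" "\<tau> \<theta> = \<theta> + of_nat i"
proof -
  have "\<tau> \<theta> ^ p - \<tau> \<theta> = \<tau> (\<theta> ^ p - \<theta>)" using assms by (simp add: Gal_hom)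
  also have "\<dots> = \<theta> ^ p - \<theta>" using assms \<theta>(1) by (intro Gal_hom(12))
  finally show thesis using AS_roots[OF p, of "\<tau> \<theta>" \<theta>] that by blast
qed

lemma (in AS_extension) Gal_eqI:
  assumes "\<tau> \<in> Gal K" "\<tau>' \<in> Gal K" "\<tau> \<theta> = \<tau>' \<theta>"
  shows "\<tau> = \<tau>'"
proof
  fix x
  obtain g where g: "g \<in> polys_over K" "poly g \<theta> = x" using gen by blast
  show "\<tau> x = \<tau>' x"
    using Gal_poly_K[OF assms(1) g(1), of \<theta>] Gal_poly_K[OF assms(2) g(1), of \<theta>] g(2) assms(3) by simp
qed

locale AS_galois = AS_extension +
  fixes \<sigma> :: "'a \<Rightarrow> 'a"
  assumes \<sigma>: "\<sigma> \<in> Gal K" "\<sigma> \<theta> = \<theta> + 1"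
begin

lemmas \<sigma>_hom = Gal_hom[OF \<sigma>(1)]
lemmas \<sigma>n_Gal = Gal_funpow[OF \<sigma>(1)]
lemmas \<sigma>n_hom = Gal_hom[OF \<sigma>n_Gal]

lemma translate_\<sigma>n:
  assumes "\<sigma> \<alpha> = \<alpha> + 1"
  shows "(\<sigma> ^^ n) \<alpha> = \<alpha> + of_nat n"
  by (induction n) (simp_all add: assms \<sigma>_hom add_ac)

lemma \<sigma>n_\<theta>: "(\<sigma> ^^ n) \<theta> = \<theta> + of_nat n"
  by (rule translate_\<sigma>n[OF \<sigma>(2)])

lemma \<sigma>_p: "\<sigma> ^^ p = id"
  using Gal_eqI[OF \<sigma>n_Gal[of p] \<sigma>n_Gal[of 0]] by (simp add: \<sigma>n_\<theta> of_nat_p)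

lemma \<sigma>n_inverse:
  assumes "i \<le> p"
  shows "(\<sigma> ^^ i) ((\<sigma> ^^ (p - i)) x) = x"
proof -
  have "(\<sigma> ^^ i) ((\<sigma> ^^ (p - i)) x) = (\<sigma> ^^ (i + (p - i))) x" by (simp only: funpow_add o_def)
  thus ?thesis using assms by (simp add: \<sigma>_p)
qed

lemma Gal_eq: "Gal K = (\<lambda>i. \<sigma> ^^ i) ` {..<p}"
proof (intro equalityI subsetI)
  fix \<tau> assume \<tau>: "\<tau> \<in> Gal K"
  obtain i where i: "i < p" "\<tau> \<theta> = \<theta> + of_nat i" using Gal_root[OF \<tau>] .
  hence "\<tau> = \<sigma> ^^ i" by (intro Gal_eqI[OF \<tau> \<sigma>n_Gal]) (simp add: \<sigma>n_\<theta>)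
  thus "\<tau> \<in> (\<lambda>i. \<sigma> ^^ i) ` {..<p}" using i by blast
qed (use \<sigma>n_Gal in auto)

lemma inj_\<sigma>n: "inj_on (\<lambda>i. \<sigma> ^^ i) {..<p}"
proof (rule inj_onI)
  fix i j assume ij: "i \<in> {..<p}" "j \<in> {..<p}" "\<sigma> ^^ i = \<sigma> ^^ j"
  hence "of_nat i = (of_nat j :: 'a)" using \<sigma>n_\<theta>[of i] \<sigma>n_\<theta>[of j] by simp
  thus "i = j" using inj_on_of_nat_char[OF p(2)] ij by (auto dest: inj_onD)
qed

lemma norm_eq: "norm_LK K x = (\<Prod>i<p. (\<sigma> ^^ i) x)"
  unfolding norm_LK_def Gal_eq by (subst prod.reindex[OF inj_\<sigma>n]) simp

text \<open>A representing polynomial of degree below \<open>p\<close> takes the value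
  \<open>x\<close> at the \<open>p\<close> conjugates of \<theta>, so it is constant.\<close>

lemma fixed_field: "\<sigma> x = x \<Longrightarrow> x \<in> K"
proof -
  assume fixed: "\<sigma> x = x"
  obtain g where g: "g \<in> polys_over K" "degree g < p" "poly g \<theta> = x" using rep .
  have x: "(\<sigma> ^^ i) x = x" for i by (induction i) (simp_all add: fixed)
  have root: "poly g (\<theta> + of_nat i) = x" for i
    using Gal_poly_K[OF \<sigma>n_Gal g(1), of i \<theta>] x g(3) by (simp add: \<sigma>n_\<theta>)
  have "g = [:x:]"
  proof (rule poly_eqI_degree[where A = "(\<lambda>i. \<theta> + of_nat i) ` {..<p}"])
    have "card ((\<lambda>i. \<theta> + of_nat i) ` {..<p}) = p"
      using inj_on_of_nat_char[OF p(2)] by (subst card_image) (auto simp: inj_on_def)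
    thus "degree g < card ((\<lambda>i. \<theta> + of_nat i) ` {..<p})" "degree [:x:] < card ((\<lambda>i. \<theta> + of_nat i) ` {..<p})"
      using g(2) p_gt by auto
  qed (auto simp: root)
  thus "x \<in> K" using polys_overD[OF g(1), of 0] by simp
qed

text \<open>A cyclic product is unchanged when its factors are shifted by one. The map is kept
  general to cover norms of elements, norms of polynomials and products of translates.\<close>

lemma \<sigma>_prod_shift:
  assumes "\<And>i. \<phi> (f i) = f (Suc i)" "f p = f 0" "\<phi> (\<Prod>i<p. f i) = (\<Prod>i<p. \<phi> (f i))"
  shows "\<phi> (\<Prod>i<p. f i) = (\<Prod>i<p. f i :: 'b::comm_monoid_mult)"
proof -
  obtain q where q: "p = Suc q" using p_gt by (cases p) auto
  have "(\<Prod>i<p. f (Suc i)) = (\<Prod>i<q. f (Suc i)) * f p"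
    unfolding q by simp
  also have "\<dots> = (\<Prod>i<p. f i)"
    using prod.lessThan_Suc_shift[of f q] assms(2) unfolding q by (simp add: mult.commute)
  finally show ?thesis by (simp add: assms(1,3))
qed

lemma norm_in_K: "norm_LK K x \<in> K"
proof (rule fixed_field)
  show "\<sigma> (norm_LK K x) = norm_LK K x"
    unfolding norm_eq
    by (rule \<sigma>_prod_shift[where f = "\<lambda>i. (\<sigma> ^^ i) x"]) (simp_all add: Gal_prod[OF \<sigma>(1)] \<sigma>_p)
qed

lemma norm_mult: "norm_LK K (x * y) = norm_LK K x * norm_LK K y"
  by (simp add: norm_eq \<sigma>n_hom prod.distrib)

lemma norm_divide: "norm_LK K (x / y) = norm_LK K x / norm_LK K y"
  by (simp add: norm_eq \<sigma>n_hom prod_dividef)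

lemma norm_zero_iff: "norm_LK K x = 0 \<longleftrightarrow> x = 0"
  using p_gt by (auto simp: norm_eq \<sigma>n_hom prod_zero_iff)

lemma norm_K: "c \<in> K \<Longrightarrow> norm_LK K c = c ^ p"
  by (simp add: norm_eq \<sigma>n_hom)

lemma norm_translate: "\<sigma> \<alpha> = \<alpha> + 1 \<Longrightarrow> norm_LK K \<alpha> = \<alpha> ^ p - \<alpha>"
  by (simp add: norm_eq translate_\<sigma>n prod_add_of_nat[OF p])

lemma AS_extension_translate:
  assumes c: "c \<in> K"
  shows "AS_extension p K (\<theta> - c)" "\<sigma> (\<theta> - c) = (\<theta> - c) + 1"
proof -
  show \<sigma>1: "\<sigma> (\<theta> - c) = (\<theta> - c) + 1" using c by (simp add: \<sigma>_hom \<sigma>)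
  show "AS_extension p K (\<theta> - c)"
  proof unfold_locales
    show "(\<theta> - c) ^ p - (\<theta> - c) \<in> K"
      using norm_translate[OF \<sigma>1] norm_in_K[of "\<theta> - c"] by simp
    show "\<theta> - c \<notin> K" using K_simps(3)[OF _ c, of "\<theta> - c"] \<theta>(2) by auto
    fix x
    obtain g where g: "g \<in> polys_over K" "poly g \<theta> = x" using gen by blast
    have "pcompose g [:c, 1:] \<in> polys_over K" by (intro polys_K g c K_simps)
    moreover have "poly (pcompose g [:c, 1:]) (\<theta> - c) = x" by (simp add: poly_pcompose g)
    ultimately show "\<exists>g\<in>polys_over K. poly g (\<theta> - c) = x" by blast
  qed (fact p K)+
qed

end

text \<open>\<open>\<sigma>\<close> translates \<theta> by some \<open>j\<close>, nonzero because
  some power of \<open>\<sigma>\<close> moves \<theta>. Then \<open>\<theta> / j\<close> moves by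
  one, and \<open>j ^ p = j\<close> preserves the form of its equation.\<close>

lemma (in AS_extension) AS_galois_rescale:
  assumes gen\<sigma>: "generates_Gal K \<sigma>"
  obtains j where "0 < j" "j < p" "\<sigma> \<theta> = \<theta> + of_nat j" "AS_galois p K (\<theta> / of_nat j) \<sigma>"
proof -
  have \<sigma>: "\<sigma> \<in> Gal K" and Gal: "Gal K = {\<sigma> ^^ n | n. True}"
    using gen\<sigma> by (auto simp: generates_Gal_def)
  obtain j where j: "j < p" "\<sigma> \<theta> = \<theta> + of_nat j" using Gal_root[OF \<sigma>] .
  have "j > 0"
  proof (rule ccontr)
    assume "\<not> j > 0"
    hence "(\<sigma> ^^ n) \<theta> = \<theta>" for n using j by (induction n) auto
    moreover obtain \<tau> where "\<tau> \<in> Gal K" "\<tau> \<theta> = \<theta> + 1" using exists_translation by blast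
    ultimately show False unfolding Gal by auto
  qed
  have nz: "of_nat j \<noteq> (0::'a)"
    using j \<open>j > 0\<close> p(2) by (auto simp: of_nat_eq_0_iff_char_dvd dest: nat_dvd_not_less)
  have *: "(\<theta> / of_nat j) ^ p - \<theta> / of_nat j = (\<theta> ^ p - \<theta>) / of_nat j"
    by (simp add: power_divide of_nat_power_char[OF p] diff_divide_distrib)
  have "AS_galois p K (\<theta> / of_nat j) \<sigma>"
  proof unfold_locales
    show "(\<theta> / of_nat j) ^ p - \<theta> / of_nat j \<in> K"
      unfolding * by (intro K_simps \<theta>)
    show "\<theta> / of_nat j \<notin> K"
      using K_simps(5)[OF _ K_simps(10), of "\<theta> / of_nat j" j] \<theta>(2) nz by auto
    fix x
    obtain g where g: "g \<in> polys_over K" "poly g \<theta> = x" using gen by blast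
    have "pcompose g [:0, of_nat j:] \<in> polys_over K" by (intro polys_K g K_simps)
    moreover have "poly (pcompose g [:0, of_nat j:]) (\<theta> / of_nat j) = x" using nz by (simp add: poly_pcompose g)
    ultimately show "\<exists>g\<in>polys_over K. poly g (\<theta> / of_nat j) = x" by blast
    show "\<sigma> \<in> Gal K" by fact
    show "\<sigma> (\<theta> / of_nat j) = \<theta> / of_nat j + 1"
      using Gal_hom[OF \<sigma>] nz j by (simp add: add_divide_distrib)
  qed (fact p K)+
  with that j \<open>j > 0\<close> show thesis by blast
qed

section \<open>The valuation ring of the extension\<close>

lemma max_ideal_iff: "x \<in> max_ideal R \<longleftrightarrow> x \<in> R \<and> (x = 0 \<or> inverse x \<notin> R)"
  by (auto simp: max_ideal_def)

lemma max_ideal_basic: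
  assumes "is_subring R"
  shows "0 \<in> max_ideal R" "1 \<notin> max_ideal R" "x \<in> max_ideal R \<Longrightarrow> x \<in> R"
    "x \<in> max_ideal R \<Longrightarrow> a \<in> R \<Longrightarrow> a * x \<in> max_ideal R"
    "x \<in> max_ideal R \<Longrightarrow> a \<in> R \<Longrightarrow> x * a \<in> max_ideal R"
    "x \<in> max_ideal R \<Longrightarrow> - x \<in> max_ideal R"
proof -
  note R = is_subringD[OF assms]
  show *: "a * x \<in> max_ideal R" if "x \<in> max_ideal R" "a \<in> R" for a x
  proof -
    have "inverse x \<in> R" if "inverse (a * x) \<in> R" "a * x \<noteq> 0"
    proof -
      have "a * inverse (a * x) \<in> R" using that \<open>a \<in> R\<close> by (intro R)
      moreover have "a * inverse (a * x) = inverse x" using that by (simp add: field_simps)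
      ultimately show ?thesis by (simp only:)
    qed
    thus ?thesis using that R by (auto simp: max_ideal_iff)
  qed
  show "x * a \<in> max_ideal R" if "x \<in> max_ideal R" "a \<in> R"
    using *[OF that] by (simp add: mult.commute)
  show "- x \<in> max_ideal R" if "x \<in> max_ideal R"
    using *[OF that R(6)[OF R(2)]] by simp
qed (use is_subringD[OF assms] in \<open>auto simp: max_ideal_iff\<close>)

lemma valuation_ringD:
  assumes "valuation_ring_of V F"
  shows "is_subring V" "V \<subseteq> F" "x \<in> F \<Longrightarrow> x \<notin> V \<Longrightarrow> inverse x \<in> V"
    "x \<in> F \<Longrightarrow> x \<notin> V \<Longrightarrow> inverse x \<in> max_ideal V"
proof -
  show "x \<in> F \<Longrightarrow> x \<notin> V \<Longrightarrow> inverse x \<in> V" for x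
    using assms is_subringD(1)[of V] by (cases "x = 0") (auto simp: valuation_ring_of_def)
  thus "x \<in> F \<Longrightarrow> x \<notin> V \<Longrightarrow> inverse x \<in> max_ideal V"
    by (auto simp: max_ideal_iff)
qed (use assms in \<open>auto simp: valuation_ring_of_def\<close>)

text \<open>One of \<open>x / y\<close> and \<open>y / x\<close> lies in \<open>V\<close>, so the
  sum is a multiple of one of the summands.\<close>

lemma valuation_ring_max_ideal_add:
  assumes V: "valuation_ring_of V F" and F: "is_subfield F" and x: "x \<in> max_ideal V" and y: "y \<in> max_ideal V"
  shows "x + y \<in> max_ideal V"
proof -
  note V' = valuation_ringD[OF V]
  note R = is_subringD[OF V'(1)]
  have *: "x + y \<in> max_ideal V" if "x \<in> max_ideal V" "x / y \<in> V" "y \<in> max_ideal V" "y \<noteq> 0" for x y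
  proof -
    have "(x / y + 1) * y \<in> max_ideal V"
      using that by (intro max_ideal_basic(4)[OF V'(1)] R)
    moreover have "(x / y + 1) * y = x + y" using that by (simp add: distrib_right)
    ultimately show ?thesis by simp
  qed
  have in_F: "x \<in> F" "y \<in> F" using x y V'(2) by (auto simp: max_ideal_iff)
  show ?thesis
  proof (cases "x = 0 \<or> y = 0")
    case True
    then show ?thesis using x y by auto
  next
    case False
    have "x / y \<in> V \<or> inverse (x / y) \<in> V"
      using is_subfieldD(2)[OF F in_F] V'(3) by blast
    hence "x / y \<in> V \<or> y / x \<in> V" by simp
    then show ?thesis using *[OF x _ y] *[OF y _ x] False by (auto simp: add.commute)
  qed
qed

text \<open>If \<open>x\<close> is not in \<open>V\<close>, its inverse is. Multiplying an integral
  equation by the power \<open>m - 1\<close> of this inverse presents \<open>x\<close> as a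
  polynomial in the inverse over \<open>V\<close>.\<close>

lemma valuation_ring_integrally_closed:
  assumes V: "valuation_ring_of V F" and x: "x \<in> F" "x \<in> integral_closure V"
  shows "x \<in> V"
proof (rule ccontr)
  assume "x \<notin> V"
  define y where "y = inverse x"
  have y: "y \<in> V" using valuation_ringD(3)[OF V x(1) \<open>x \<notin> V\<close>] by (simp add: y_def)
  note R = is_subringD[OF valuation_ringD(1)[OF V]]
  have "x \<noteq> 0" using \<open>x \<notin> V\<close> R by auto
  obtain m C where C: "m > 0" "\<And>i j. i < m \<Longrightarrow> j < m \<Longrightarrow> C i j \<in> V"
    "\<And>i. i < m \<Longrightarrow> x * x ^ i = (\<Sum>j<m. C i j * x ^ j)"
    using integral_power_basis[OF valuation_ringD(1)[OF V] x(2)] by blast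
  have "x = x * x ^ (m - 1) * y ^ (m - 1)"
    using \<open>x \<noteq> 0\<close> by (simp add: y_def power_inverse)
  also have "\<dots> = (\<Sum>j<m. C (m - 1) j * (x ^ j * y ^ (m - 1)))"
    using C(1) by (simp add: C(3) sum_distrib_right mult.assoc)
  also have "\<dots> = (\<Sum>j<m. C (m - 1) j * y ^ (m - 1 - j))"
  proof (rule sum.cong)
    fix j assume "j \<in> {..<m}"
    hence "m - 1 = j + (m - 1 - j)" by auto
    hence "y ^ (m - 1) = y ^ j * y ^ (m - 1 - j)" by (metis power_add)
    moreover have "x ^ j * y ^ j = 1" using \<open>x \<noteq> 0\<close> by (simp add: y_def power_inverse)
    ultimately have "x ^ j * y ^ (m - 1) = y ^ (m - 1 - j)" by (metis mult.assoc mult_1)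
    thus "C (m - 1) j * (x ^ j * y ^ (m - 1)) = C (m - 1) j * y ^ (m - 1 - j)" by simp
  qed simp
  also have "\<dots> \<in> V"
    using C(1) by (intro subring_sum[OF valuation_ringD(1)[OF V]] R C(2) subring_power[OF valuation_ringD(1)[OF V]] y) auto
  finally show False using \<open>x \<notin> V\<close> by contradiction
qed

text \<open>The element \<open>a\<close> has the largest absolute value in \<open>S\<close>.
  Dividing a polynomial by such a coefficient puts all coefficients into \<open>V\<close> and makes
  one of them 1.\<close>

lemma valuation_ring_finite_dominant:
  assumes V: "valuation_ring_of V F" and F: "is_subfield F"
    and S: "finite S" "S \<noteq> {}" "S \<subseteq> F - {0}"
  shows "\<exists>a\<in>S. \<forall>b\<in>S. b / a \<in> V"
  using S
proof (induction S rule: finite_ne_induct)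
  case (singleton x)
  then show ?case using is_subringD(2)[OF valuation_ringD(1)[OF V]] by auto
next
  case (insert x S)
  note R = is_subringD[OF valuation_ringD(1)[OF V]]
  obtain a where a: "a \<in> S" "\<forall>b\<in>S. b / a \<in> V" using insert by auto
  have nz: "a \<noteq> 0" "x \<noteq> 0" using insert a by auto
  show ?case
  proof (cases "x / a \<in> V")
    case True
    then show ?thesis using a by auto
  next
    case False
    have "x / a \<in> F" using insert a by (intro is_subfieldD[OF F]) auto
    hence *: "a / x \<in> V" using valuation_ringD(3)[OF V _ False] by simp
    have "b / x \<in> V" if "b \<in> S" for b
      using R(5)[OF a(2)[rule_format, OF that] *] nz by simp
    then show ?thesis using nz R(2) by auto
  qed
qed

section \<open>Maximal ideals\<close>

definition ideal_of :: "'a::field set \<Rightarrow> 'a set \<Rightarrow> bool" where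
  "ideal_of R M \<longleftrightarrow> M \<subseteq> R \<and> 0 \<in> M \<and> (\<forall>x\<in>M. \<forall>y\<in>M. x + y \<in> M) \<and> (\<forall>a\<in>R. \<forall>x\<in>M. a * x \<in> M)"

text \<open>Zorn's lemma for the proper ideals containing the nonunit \<open>x\<close>. The last
  property expresses maximality through elements: \<open>y\<close> is invertible modulo
  \<open>M\<close>.\<close>

lemma maximal_ideal_exists:
  assumes R: "is_subring R" and x: "x \<in> max_ideal R"
  obtains M where "ideal_of R M" "x \<in> M" "1 \<notin> M"
    "\<And>y. y \<in> R \<Longrightarrow> y \<notin> M \<Longrightarrow> \<exists>b\<in>R. 1 - b * y \<in> M"
proof -
  note RR = is_subringD[OF R]
  define \<A> where "\<A> = {M. ideal_of R M \<and> x \<in> M \<and> 1 \<notin> M}"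
  have "\<A> \<noteq> {}"
  proof -
    define I where "I = (\<lambda>b. b * x) ` R"
    have "1 \<notin> I"
    proof
      assume "1 \<in> I"
      then obtain b where b: "b \<in> R" "1 = b * x" by (auto simp: I_def)
      hence "x \<noteq> 0" "inverse x = b" by (auto simp: inverse_unique mult.commute)
      with x b show False by (auto simp: max_ideal_iff)
    qed
    moreover have "x \<in> I" using RR by (auto simp: I_def intro!: image_eqI[of _ _ 1])
    moreover have "ideal_of R I"
    proof -
      have "b * x + c * x \<in> I" "a * (b * x) \<in> I" if "a \<in> R" "b \<in> R" "c \<in> R" for a b c
      proof -
        show "b * x + c * x \<in> I"
          unfolding I_def by (rule image_eqI[OF _ RR(3)[OF that(2,3)]]) (simp add: distrib_right)
        show "a * (b * x) \<in> I"
          unfolding I_def by (rule image_eqI[OF _ RR(5)[OF that(1,2)]]) (simp add: mult.assoc)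
      qed
      thus ?thesis
        using RR x by (auto simp: ideal_of_def I_def max_ideal_iff intro!: image_eqI[of _ _ 0])
    qed
    ultimately show ?thesis by (auto simp: \<A>_def)
  qed
  moreover have "\<Union>\<C> \<in> \<A>" if C: "\<C> \<noteq> {}" "subset.chain \<A> \<C>" for \<C>
  proof -
    have sub: "\<C> \<subseteq> \<A>" and lin: "\<And>I J. I \<in> \<C> \<Longrightarrow> J \<in> \<C> \<Longrightarrow> I \<subseteq> J \<or> J \<subseteq> I"
      using C(2) by (auto simp: subset.chain_def)
    have "a + b \<in> \<Union>\<C>" if ab: "a \<in> \<Union>\<C>" "b \<in> \<Union>\<C>" for a b
    proof -
      obtain I J where IJ: "I \<in> \<C>" "a \<in> I" "J \<in> \<C>" "b \<in> J" using ab by blast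
      then obtain I where "I \<in> \<C>" "a \<in> I" "b \<in> I" using lin[OF IJ(1,3)] by blast
      with sub have "a + b \<in> I" by (auto simp: \<A>_def ideal_of_def)
      with \<open>I \<in> \<C>\<close> show ?thesis by blast
    qed
    moreover have "a * b \<in> \<Union>\<C>" if "a \<in> R" "b \<in> \<Union>\<C>" for a b
      using that sub by (auto simp: \<A>_def ideal_of_def)
    moreover have "\<Union>\<C> \<subseteq> R" "1 \<notin> \<Union>\<C>" using sub by (auto simp: \<A>_def ideal_of_def)
    moreover have "0 \<in> \<Union>\<C>" "x \<in> \<Union>\<C>" using C(1) sub by (auto simp: \<A>_def ideal_of_def)
    ultimately show ?thesis
      by (simp add: \<A>_def ideal_of_def)
  qed
  ultimately have "\<exists>M\<in>\<A>. \<forall>I\<in>\<A>. M \<subseteq> I \<longrightarrow> I = M"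
    by (rule subset_Zorn_nonempty)
  then obtain M where M: "M \<in> \<A>" and max: "\<And>I. I \<in> \<A> \<Longrightarrow> M \<subseteq> I \<Longrightarrow> I = M"
    by blast
  have Mid: "ideal_of R M" "x \<in> M" "1 \<notin> M" using M by (auto simp: \<A>_def)
  have "\<exists>b\<in>R. 1 - b * y \<in> M" if y: "y \<in> R" "y \<notin> M" for y
  proof -
    define I where "I = {m + b * y | m b. m \<in> M \<and> b \<in> R}"
    have MI: "M \<subseteq> I" using RR(1) by (force simp: I_def)
    have yI: "y \<in> I"
      using Mid RR(2) unfolding I_def ideal_of_def by (intro CollectI exI[of _ 0] exI[of _ 1]) auto
    have I: "ideal_of R I"
      unfolding ideal_of_def
    proof (intro conjI ballI)
      show "I \<subseteq> R" using Mid y RR by (auto simp: I_def ideal_of_def)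
      show "0 \<in> I" using Mid MI by (auto simp: ideal_of_def)
      show "u + v \<in> I" if "u \<in> I" "v \<in> I" for u v
      proof -
        obtain m b m' b' where "u = m + b * y" "v = m' + b' * y" "m \<in> M" "m' \<in> M" "b \<in> R" "b' \<in> R"
          using \<open>u \<in> I\<close> \<open>v \<in> I\<close> by (auto simp: I_def)
        thus ?thesis using Mid RR
          unfolding I_def ideal_of_def by (intro CollectI exI[of _ "m + m'"] exI[of _ "b + b'"]) (auto simp: algebra_simps)
      qed
      show "a * v \<in> I" if "a \<in> R" "v \<in> I" for a v
      proof -
        obtain m b where "v = m + b * y" "m \<in> M" "b \<in> R"
          using \<open>v \<in> I\<close> by (auto simp: I_def)
        thus ?thesis using Mid RR \<open>a \<in> R\<close>
          unfolding I_def ideal_of_def by (intro CollectI exI[of _ "a * m"] exI[of _ "a * b"]) (auto simp: algebra_simps)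
      qed
    qed
    have "1 \<in> I"
      using max[of I] I MI yI y(2) Mid(2) by (auto simp: \<A>_def)
    then obtain m b where "1 = m + b * y" "m \<in> M" "b \<in> R" by (auto simp: I_def)
    moreover from this have "1 - b * y = m" by (metis add_diff_cancel_right')
    ultimately show ?thesis by (intro bexI[of _ b]) simp_all
  qed
  with Mid that show thesis by blast
qed

section \<open>The integral closure as a local ring and as a valuation ring\<close>

locale AS_valued = AS_galois +
  fixes A :: "'a set"
  assumes A: "valuation_ring_of A K" and hensel: "henselian A"
begin

abbreviation B :: "'a set" where "B \<equiv> integral_closure A"

lemmas Ar = valuation_ringD(1)[OF A]
lemmas A_simps = is_subringD[OF Ar] subring_power[OF Ar] subring_of_nat[OF Ar]
lemmas Br = integral_closure_subring(1)[OF Ar]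
lemmas B_simps = is_subringD[OF Br] subring_power[OF Br] subring_of_nat[OF Br]
lemmas polys_B = polys_over_closed[OF Br]
lemmas polys_A = polys_over_closed[OF Ar]
lemmas mA = max_ideal_basic[OF Ar] valuation_ring_max_ideal_add[OF A K]

lemma A_sub: "x \<in> A \<Longrightarrow> x \<in> K" "x \<in> A \<Longrightarrow> x \<in> B"
  using valuation_ringD(2)[OF A] integral_closure_subring(2)[OF Ar] by auto

lemma BK_A: "x \<in> B \<Longrightarrow> x \<in> K \<Longrightarrow> x \<in> A"
  by (rule valuation_ring_integrally_closed[OF A])

lemma Gal_B:
  assumes "\<tau> \<in> Gal K" "x \<in> B"
  shows "\<tau> x \<in> B"
proof -
  obtain f where f: "f \<in> polys_over A" "lead_coeff f = 1" "poly f x = 0"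
    using assms(2) by (auto simp: integral_closure_iff)
  have "f \<in> polys_over K" using f(1) A_sub by (auto simp: polys_over_def)
  hence "poly f (\<tau> x) = 0"
    using Gal_poly_K[OF assms(1), of f x] f(3) Gal_hom(3)[OF assms(1)] by simp
  thus ?thesis using f by (auto simp: integral_closure_iff)
qed

lemma \<sigma>n_B: "x \<in> B \<Longrightarrow> (\<sigma> ^^ n) x \<in> B"
  by (rule Gal_B[OF \<sigma>n_Gal])

lemma norm_A: "x \<in> B \<Longrightarrow> norm_LK K x \<in> A"
  by (rule BK_A[OF _ norm_in_K]) (auto simp: norm_eq intro!: subring_prod[OF Br] \<sigma>n_B)

text \<open>\<sigma> permutes the factors cyclically, so the coefficients of the product lie in
  \<open>K\<close>; lying in \<open>B\<close> as well, they are in \<open>A\<close>.\<close>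

lemma polys_norm_A:
  assumes f: "f \<in> polys_over B"
  shows "(\<Prod>i<p. map_poly (\<sigma> ^^ i) f) \<in> polys_over A"
proof (rule polys_overI)
  fix n
  let ?F = "\<Prod>i<p. map_poly (\<sigma> ^^ i) f"
  have "?F \<in> polys_over B"
    by (intro polys_over_prod[OF Br] polys_overI)
      (simp add: coeff_map_poly \<sigma>n_hom \<sigma>n_B polys_overD[OF f])
  hence cB: "coeff ?F n \<in> B" by (rule polys_overD)
  have "map_poly \<sigma> ?F = ?F"
    by (rule \<sigma>_prod_shift[where f = "\<lambda>i. map_poly (\<sigma> ^^ i) f"])
      (simp_all add: map_poly_map_poly \<sigma>_hom \<sigma>_p Gal_map_poly_prod[OF \<sigma>(1)])
  hence "\<sigma> (coeff ?F n) = coeff ?F n"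
    by (metis coeff_map_poly \<sigma>_hom(3))
  thus "coeff ?F n \<in> A" using cB fixed_field BK_A by blast
qed

lemma poly_norm_eq_0:
  assumes "poly f x = 0"
  shows "poly (\<Prod>i<p. map_poly (\<sigma> ^^ i) f) x = 0"
  using p_gt assms by (auto simp: poly_prod prod_zero_iff intro!: bexI[of _ 0])

lemma lead_coeff_norm:
  "lead_coeff f = 1 \<Longrightarrow> lead_coeff (\<Prod>i<p. map_poly (\<sigma> ^^ i) f) = 1"
  by (simp add: lead_coeff_prod Gal_map_poly_lead_coeff[OF \<sigma>n_Gal] \<sigma>n_hom)

text \<open>The product of the conjugates of \<open>f\<close> is monic over \<open>A\<close> and
  still has the root \<open>z\<close>.\<close>

lemma B_integrally_closed:
  assumes "f \<in> polys_over B" "lead_coeff f = 1" "poly f z = 0"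
  shows "z \<in> B"
  unfolding integral_closure_iff
  using polys_norm_A[OF assms(1)] lead_coeff_norm[OF assms(2)] poly_norm_eq_0[OF assms(3)] by blast

text \<open>If \<open>M\<close> is not \<open>\<sigma>\<close>-stable, its \<open>p\<close> conjugates are distinct, so some \<open>x\<close> is \<open>1\<close> modulo \<open>M\<close> and \<open>0\<close>
  modulo the other conjugates. Then \<open>1\<close> is a simple root modulo \<open>max_ideal A\<close> of the characteristic
  polynomial of \<open>x\<close>, which by Hensel puts \<open>x\<close> in \<open>K\<close>, a contradiction. A \<open>\<sigma>\<close>-stable \<open>M\<close> contains every
  nonunit because it contains its norm.\<close>

lemma B_local_aux:
  assumes M: "ideal_of B M" "1 \<notin> M" and max: "\<And>y. y \<in> B \<Longrightarrow> y \<notin> M \<Longrightarrow> \<exists>b\<in>B. 1 - b * y \<in> M"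
  shows "y \<in> max_ideal B \<longleftrightarrow> y \<in> M"
proof -
  have MB: "\<And>x. x \<in> M \<Longrightarrow> x \<in> B" and M0: "0 \<in> M" and Madd: "\<And>x y. x \<in> M \<Longrightarrow> y \<in> M \<Longrightarrow> x + y \<in> M"
    and Mmult: "\<And>a x. a \<in> B \<Longrightarrow> x \<in> M \<Longrightarrow> a * x \<in> M"
    using M(1) by (auto simp: ideal_of_def)
  have Mdiff: "x - y \<in> M" if "x \<in> M" "y \<in> M" for x y
    using Madd[OF that(1) Mmult[OF B_simps(6)[OF B_simps(2)] that(2)]] by simp
  have prime: "b \<in> M" if ab: "a \<in> B" "b \<in> B" "a * b \<in> M" "a \<notin> M" for a b
  proof -
    obtain c where c: "c \<in> B" "1 - c * a \<in> M" using max[OF ab(1,4)] by blast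
    have "b * (1 - c * a) + c * (a * b) \<in> M"
      by (intro Madd Mmult ab c)
    moreover have "b * (1 - c * a) + c * (a * b) = b" by (simp add: algebra_simps)
    ultimately show ?thesis by simp
  qed
  have prime_prod: "\<exists>i\<in>I. f i \<in> M" if "finite I" "\<And>i. i \<in> I \<Longrightarrow> f i \<in> B" "prod f I \<in> M" for f and I :: "nat set"
    using that
  proof (induction I rule: finite_induct)
    case (insert i I)
    then show ?case using prime[of "f i" "prod f I"] subring_prod[OF Br, of I f] by auto
  qed (use M(2) in auto)
  have prod_M: "prod f I \<in> M" if "finite I" "\<And>i. i \<in> I \<Longrightarrow> f i \<in> B" "k \<in> I" "f k \<in> M" for f k and I :: "nat set"
    using Mmult[OF subring_prod[OF Br, of "I - {k}" f] that(4)] that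
    by (simp add: prod.remove[of I k] mult.commute)
  have A_M: "a \<in> max_ideal A" if "a \<in> A" "a \<in> M" for a
  proof -
    have "a = 0 \<or> inverse a \<notin> A"
      using Mmult[OF A_sub(2)[of "inverse a"] that(2)] M(2) by auto
    thus ?thesis using that by (simp add: max_ideal_iff)
  qed
  have mA_M: "a \<in> M" if a: "a \<in> max_ideal A" for a
  proof (rule ccontr)
    assume "a \<notin> M"
    have aA: "a \<in> A" using a by (simp add: max_ideal_iff)
    obtain b where b: "b \<in> B" "1 - b * a \<in> M" using max[OF A_sub(2)[OF aA] \<open>a \<notin> M\<close>] by blast
    \<comment> \<open>The norm of \<open>1 - b * a\<close> has the form \<open>1 - a * z\<close>,
      where \<open>z\<close> turns out to lie in \<open>A\<close>. The norm and \<open>a\<close>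
      both lie in the maximal ideal of \<open>A\<close>, which would then contain 1.\<close>
    have "\<exists>z\<in>B. (\<Prod>i<n. 1 - a * (\<sigma> ^^ i) b) = 1 - a * z" for n
    proof (induction n)
      case 0
      show ?case by (intro bexI[of _ 0]) (auto intro: B_simps)
    next
      case (Suc n)
      then obtain z where z: "z \<in> B" "(\<Prod>i<n. 1 - a * (\<sigma> ^^ i) b) = 1 - a * z" by blast
      have "z + (\<sigma> ^^ n) b - a * z * (\<sigma> ^^ n) b \<in> B"
        by (intro B_simps z A_sub aA \<sigma>n_B b)
      thus ?case by (intro bexI[of _ "z + (\<sigma> ^^ n) b - a * z * (\<sigma> ^^ n) b"]) (auto simp: z algebra_simps)
    qed
    then obtain z where z: "z \<in> B" "(\<Prod>i<p. 1 - a * (\<sigma> ^^ i) b) = 1 - a * z" by blast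
    define N where "N = norm_LK K (1 - b * a)"
    have Neq: "N = (\<Prod>i<p. 1 - a * (\<sigma> ^^ i) b)"
      by (simp add: N_def norm_eq \<sigma>n_hom \<sigma>n_hom(12)[OF A_sub(1)[OF aA]] mult.commute)
    have "N \<in> M"
      unfolding N_def norm_eq
      by (rule prod_M[where k = 0]) (use p_gt b MB \<sigma>n_B in auto)
    moreover have "N \<in> A" unfolding N_def by (rule norm_A[OF MB[OF b(2)]])
    ultimately have Nm: "N \<in> max_ideal A" by (rule A_M[rotated])
    have "a \<noteq> 0" using M0 \<open>a \<notin> M\<close> by auto
    hence "z = (1 - N) / a" by (simp add: Neq z(2))
    hence "z \<in> K" using A_sub(1)[OF \<open>N \<in> A\<close>] A_sub(1)[OF aA] by (auto intro: K_simps)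
    hence "z \<in> A" using z BK_A by blast
    have "a * z + N \<in> max_ideal A"
      by (rule mA(7)[OF mA(5)[OF a \<open>z \<in> A\<close>] Nm])
    thus False using mA(2) by (simp add: Neq z(2))
  qed
  have "\<exists>i\<in>{1..<p}. (\<sigma> ^^ i) ` M \<subseteq> M"
  proof (rule ccontr)
    assume "\<not> ?thesis"
    hence "\<forall>i\<in>{1..<p}. \<exists>u\<in>M. (\<sigma> ^^ i) u \<notin> M" by blast
    then obtain u where u: "\<And>i. i \<in> {1..<p} \<Longrightarrow> u i \<in> M" "\<And>i. i \<in> {1..<p} \<Longrightarrow> (\<sigma> ^^ i) (u i) \<notin> M"
      by metis
    have uB: "(\<sigma> ^^ i) (u i) \<in> B" if "i \<in> {1..<p}" for i
      using u(1)[OF that] MB \<sigma>n_B by blast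
    \<comment> \<open>For \<open>0 < j < p\<close> the conjugate \<open>\<sigma>^j U\<close> has the
      factor \<open>u (p - j)\<close> and so lies in \<open>M\<close>, while \<open>U\<close> itself
      avoids the prime ideal \<open>M\<close>.\<close>
    define U where "U = (\<Prod>i\<in>{1..<p}. (\<sigma> ^^ i) (u i))"
    have UB: "U \<in> B" unfolding U_def by (intro subring_prod[OF Br] uB)
    have "U \<notin> M"
      using prime_prod[of "{1..<p}" "\<lambda>i. (\<sigma> ^^ i) (u i)"] u(2) uB by (auto simp: U_def)
    then obtain v where v: "v \<in> B" "1 - v * U \<in> M" using max UB by blast
    define x where "x = v * U"
    have xB: "x \<in> B" using v UB by (auto simp: x_def intro: B_simps)
    have conj_M: "(\<sigma> ^^ j) x \<in> M" if j: "j \<in> {1..<p}" for j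
    proof -
      have "(\<sigma> ^^ j) U = (\<Prod>i\<in>{1..<p}. (\<sigma> ^^ j) ((\<sigma> ^^ i) (u i)))"
        by (simp add: U_def Gal_prod[OF \<sigma>n_Gal])
      also have "\<dots> \<in> M"
      proof (rule prod_M[where k = "p - j"])
        show "(\<sigma> ^^ j) ((\<sigma> ^^ (p - j)) (u (p - j))) \<in> M"
          using \<sigma>n_inverse[of j "u (p - j)"] u(1)[of "p - j"] j by auto
      qed (use j uB \<sigma>n_B in auto)
      finally show ?thesis
        unfolding x_def \<sigma>n_hom(2) by (intro Mmult \<sigma>n_B v)
    qed
    define R where "R = (\<Prod>i\<in>{1..<p}. [:- (\<sigma> ^^ i) x, 1:])"
    define \<chi> where "\<chi> = (\<Prod>i<p. map_poly (\<sigma> ^^ i) [:-x, 1:])"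
    have \<chi>_R: "\<chi> = [:-x, 1:] * R"
    proof -
      have "{..<p} = insert 0 {1..<p}" using p_gt by auto
      thus ?thesis by (simp add: \<chi>_def R_def map_poly_pCons \<sigma>n_hom)
    qed
    have lin: "[:-x, 1:] \<in> polys_over B" by (intro polys_B B_simps xB)
    have R_B: "R \<in> polys_over B"
      unfolding R_def by (intro polys_over_prod[OF Br] polys_B B_simps \<sigma>n_B xB)
    have \<chi>: "\<chi> \<in> polys_over A" unfolding \<chi>_def by (rule polys_norm_A[OF lin])
    have "poly \<chi> 1 = poly R 1 * (1 - v * U)"
      by (simp add: \<chi>_R x_def algebra_simps)
    hence "poly \<chi> 1 \<in> M"
      using Mmult[OF polys_B(11)[OF R_B B_simps(2)] v(2)] by simp
    hence 1: "poly \<chi> 1 \<in> max_ideal A"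
      by (intro A_M polys_A(11)[OF \<chi>] A_simps)
    have 2: "poly (pderiv \<chi>) 1 \<notin> max_ideal A"
    proof
      assume "poly (pderiv \<chi>) 1 \<in> max_ideal A"
      moreover have "pderiv \<chi> = [:-x, 1:] * pderiv R + R"
        unfolding \<chi>_R pderiv_mult by (simp add: pderiv_pCons)
      ultimately have "(1 - x) * poly (pderiv R) 1 + poly R 1 \<in> M"
        using mA_M by (simp add: algebra_simps)
      moreover have "poly (pderiv R) 1 * (1 - x) \<in> M"
        using v(2) by (intro Mmult polys_B(11) polys_B(9) R_B B_simps) (simp add: x_def)
      ultimately have "poly R 1 \<in> M"
        using Mdiff by (metis add_diff_cancel_left' mult.commute)
      hence "(\<Prod>i\<in>{1..<p}. 1 - (\<sigma> ^^ i) x) \<in> M" by (simp add: R_def poly_prod)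
      hence "\<exists>i\<in>{1..<p}. 1 - (\<sigma> ^^ i) x \<in> M"
        by (intro prime_prod B_simps \<sigma>n_B xB) auto
      then obtain i where i: "i \<in> {1..<p}" "1 - (\<sigma> ^^ i) x \<in> M" by blast
      have "(1 - (\<sigma> ^^ i) x) + (\<sigma> ^^ i) x \<in> M" by (intro Madd i conj_M)
      thus False using M(2) by simp
    qed
    have "lead_coeff \<chi> = 1" unfolding \<chi>_def by (rule lead_coeff_norm) simp
    \<comment> \<open>The root in \<open>A\<close> is a conjugate of \<open>x\<close>, so
      \<open>x\<close> is fixed by \<sigma>; but \<open>x\<close> is 1 modulo \<open>M\<close> and
      \<open>\<sigma> x\<close> is 0.\<close>
    then obtain b where b: "b \<in> A" "poly \<chi> b = 0"
      using hensel 1 2 A_simps(2) polys_overD[OF \<chi>] unfolding henselian_def by blast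
    then obtain i where i: "i < p" "b = (\<sigma> ^^ i) x"
      by (auto simp: \<chi>_def poly_prod prod_zero_iff map_poly_pCons \<sigma>n_hom)
    have "(\<sigma> ^^ (p - i)) b = x"
      using \<sigma>n_inverse[of "p - i" x] i by simp
    hence "x = b" using \<sigma>n_hom(12)[OF A_sub(1)[OF b(1)]] by simp
    hence "\<sigma> x = x" using \<sigma>_hom(12)[OF A_sub(1)[OF b(1)]] by simp
    hence "x \<in> M" using conj_M[of 1] p_gt by auto
    with v(2) have "(1 - x) + x \<in> M" by (intro Madd) (simp_all add: x_def)
    thus False using M(2) by simp
  qed
  then obtain i where "i \<in> {1..<p}" "(\<sigma> ^^ i) ` M \<subseteq> M" by blast
  hence i: "0 < i" "i < p" "(\<sigma> ^^ i) ` M \<subseteq> M" by auto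
  have \<sigma>M: "\<sigma> x \<in> M" if "x \<in> M" for x
  proof -
    \<comment> \<open>As \<open>i\<close> is prime to \<open>p\<close>, some power of
      \<open>\<sigma> ^^ i\<close> is \<sigma> itself.\<close>
    have "coprime i p" using i p(1) by (metis coprime_commute nat_dvd_not_less prime_imp_coprime)
    then obtain k where "[i * k = 1] (mod p)" using cong_solve_coprime_nat by auto
    hence "(i * k) mod p = 1" using p_gt by (simp add: cong_def)
    then obtain t where t: "i * k = p * t + 1" by (metis mult.commute div_mult_mod_eq)
    have pt: "(\<sigma> ^^ (p * t)) z = z" for z by (simp add: funpow_mult [symmetric] \<sigma>_p)
    have "((\<sigma> ^^ i) ^^ k) x \<in> M" using that i(3) by (induction k) auto
    hence "(\<sigma> ^^ (p * t + 1)) x \<in> M" by (simp only: funpow_mult t)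
    thus ?thesis by (simp add: pt)
  qed
  have \<sigma>nM: "(\<sigma> ^^ n) x \<in> M" if "x \<in> M" for x n
    using that \<sigma>M by (induction n) auto
  show ?thesis
  proof
    assume y: "y \<in> max_ideal B"
    have yB: "y \<in> B" using y by (simp add: max_ideal_iff)
    have "norm_LK K y \<in> max_ideal A"
    proof (rule ccontr)
      assume "norm_LK K y \<notin> max_ideal A"
      hence *: "norm_LK K y \<noteq> 0" "inverse (norm_LK K y) \<in> A"
        using norm_A[OF yB] by (auto simp: max_ideal_iff)
      have "{..<p} = insert 0 {1..<p}" using p_gt by auto
      hence "norm_LK K y = y * (\<Prod>i\<in>{1..<p}. (\<sigma> ^^ i) y)" by (simp add: norm_eq)
      hence "inverse y = inverse (norm_LK K y) * (\<Prod>i\<in>{1..<p}. (\<sigma> ^^ i) y)"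
        using *(1) by (simp add: field_simps)
      also have "\<dots> \<in> B"
        by (intro B_simps A_sub * subring_prod[OF Br] \<sigma>n_B yB)
      finally show False using y *(1) norm_zero_iff by (auto simp: max_ideal_iff)
    qed
    hence "(\<Prod>i<p. (\<sigma> ^^ i) y) \<in> M" unfolding norm_eq by (rule mA_M)
    then obtain i where "i < p" "(\<sigma> ^^ i) y \<in> M"
      using prime_prod[of "{..<p}" "\<lambda>i. (\<sigma> ^^ i) y"] \<sigma>n_B[OF yB] by auto
    thus "y \<in> M" using \<sigma>nM[of "(\<sigma> ^^ i) y" "p - i"] \<sigma>n_inverse[of "p - i" y] by simp
  next
    assume "y \<in> M"
    thus "y \<in> max_ideal B"
      using MB Mmult[of "inverse y" y] M(2) by (auto simp: max_ideal_iff)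
  qed
qed

text \<open>\<open>B_local_aux\<close> identifies a maximal ideal with the set of all nonunits, so
  this set is closed under addition.\<close>

lemma mB_add: "x \<in> max_ideal B \<Longrightarrow> y \<in> max_ideal B \<Longrightarrow> x + y \<in> max_ideal B"
proof -
  assume xy: "x \<in> max_ideal B" "y \<in> max_ideal B"
  obtain M where M: "ideal_of B M" "1 \<notin> M" "\<And>y. y \<in> B \<Longrightarrow> y \<notin> M \<Longrightarrow> \<exists>b\<in>B. 1 - b * y \<in> M"
    using maximal_ideal_exists[OF Br xy(1)] by blast
  thus ?thesis using B_local_aux[OF M] xy by (simp add: ideal_of_def)
qed

lemmas mB = max_ideal_basic[OF Br] mB_add

lemma mB_diff: "x \<in> max_ideal B \<Longrightarrow> y \<in> max_ideal B \<Longrightarrow> x - y \<in> max_ideal B"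
  using mB_add[OF _ mB(6)[of y]] by simp

text \<open>With leading coefficient \<open>a\<^sub>n\<close> in the maximal ideal, \<open>c = a\<^sub>n x\<close> is integral, so
  \<open>a\<^sub>n T\<^sup>n\<close> can be traded for \<open>c T\<^bsup>n-1\<^esup>\<close>.\<close>

lemma B_valuation_aux:
  assumes "P \<in> polys_over B" "degree P \<le> n" "poly P x = 0" "coeff P k \<notin> max_ideal B"
  shows "x \<in> B \<or> inverse x \<in> B"
  using assms
proof (induction n arbitrary: P)
  case 0
  then obtain c where "P = [:c:]" by (auto elim: degree_eq_zeroE)
  with 0 show ?case using mB(1) by (auto simp: coeff_pCons split: nat.splits)
next
  case (Suc n P)
  define a where "a = coeff P (Suc n)"
  have aB: "a \<in> B" using Suc.prems(1) by (auto simp: a_def polys_over_def)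
  show ?case
  proof (cases "a \<in> max_ideal B")
    case False
    hence inv: "a \<noteq> 0" "inverse a \<in> B" using aB by (auto simp: max_ideal_iff)
    hence deg: "degree P = Suc n" using Suc.prems(2) by (metis a_def le_antisym le_degree)
    have "x \<in> B"
      by (rule B_integrally_closed[of "smult (inverse a) P"])
        (use Suc.prems inv deg in \<open>auto simp: a_def intro!: polys_B\<close>)
    thus ?thesis ..
  next
    case am: True
    define c where "c = a * x"
    have sum: "(\<Sum>i\<le>n. coeff P i * x ^ i) + a * x ^ Suc n = 0"
    proof -
      have "poly P x = (\<Sum>i\<le>Suc n. coeff P i * x ^ i)"
        unfolding poly_altdef using Suc.prems(2) by (intro sum.mono_neutral_left) (auto simp: coeff_eq_0)
      thus ?thesis using Suc.prems(3) by (simp add: a_def)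
    qed
    \<comment> \<open>\<open>Q(a T) = a^n P(T)\<close>, so \<open>Q\<close> is monic over
      \<open>B\<close> with root \<open>c\<close>.\<close>
    define Q where "Q = monom 1 (Suc n) + (\<Sum>i\<le>n. monom (coeff P i * a ^ (n - i)) i)"
    have cQ: "coeff Q j = (if j = Suc n then 1 else if j \<le> n then coeff P j * a ^ (n - j) else 0)" for j
      by (auto simp: Q_def coeff_sum coeff_monom)
    have "degree Q = Suc n"
      by (rule antisym[OF degree_le le_degree]) (auto simp: cQ)
    hence lQ: "lead_coeff Q = 1" by (simp add: cQ)
    have "Q \<in> polys_over B"
      using Suc.prems(1) aB by (auto simp: polys_over_def cQ intro!: B_simps)
    moreover have "poly Q c = a ^ n * ((\<Sum>i\<le>n. coeff P i * x ^ i) + a * x ^ Suc n)"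
    proof -
      have "coeff P i * a ^ (n - i) * c ^ i = a ^ n * (coeff P i * x ^ i)" if "i \<le> n" for i
        using power_add[of a "n - i" i] that by (simp add: c_def power_mult_distrib mult_ac)
      hence "(\<Sum>i\<le>n. coeff P i * a ^ (n - i) * c ^ i) = (\<Sum>i\<le>n. a ^ n * (coeff P i * x ^ i))"
        by (intro sum.cong) auto
      thus ?thesis
        by (simp add: Q_def poly_sum poly_monom sum_distrib_left distrib_left c_def power_mult_distrib mult_ac)
    qed
    ultimately have cB: "c \<in> B" using lQ sum by (intro B_integrally_closed[of Q]) auto
    show ?thesis
    proof (cases "c \<in> max_ideal B")
      case False
      hence "c \<noteq> 0" "inverse c \<in> B" using cB by (auto simp: max_ideal_iff)
      moreover have "inverse x = a * inverse c" using \<open>c \<noteq> 0\<close> by (auto simp: c_def field_simps)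
      ultimately show ?thesis using aB by (auto intro: B_simps)
    next
      case cm: True
      \<comment> \<open>The degree bound drops to \<open>n\<close> and the value at \<open>x\<close>
        is kept; the coefficients change only by nonunits, so coefficient \<open>k\<close> remains a
        unit.\<close>
      define P' where "P' = P - monom a (Suc n) + monom c n"
      have "P' \<in> polys_over B"
        unfolding P'_def by (intro polys_B Suc.prems aB cB)
      moreover have "degree P' \<le> n"
        using Suc.prems(2) by (intro degree_le) (auto simp: P'_def coeff_monom a_def coeff_eq_0 Suc_le_eq)
      moreover have "poly P' x = 0"
        using Suc.prems(3) by (simp add: P'_def poly_monom c_def)
      moreover have "coeff P' k \<notin> max_ideal B"
      proof
        assume m: "coeff P' k \<in> max_ideal B"
        have "coeff P k = coeff P' k + (if k = Suc n then a else 0) - (if k = n then c else 0)"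
          by (simp add: P'_def coeff_monom)
        also have "\<dots> \<in> max_ideal B"
          using m am cm mB(1) by (intro mB_diff mB) auto
        finally show False using Suc.prems(4) by contradiction
      qed
      ultimately show ?thesis by (rule Suc.IH)
    qed
  qed
qed

text \<open>The product of the conjugates of \<open>T - x\<close> is a polynomial over
  \<open>K\<close>. Divided by its largest coefficient it meets the conditions of
  \<open>B_valuation_aux\<close>.\<close>

lemma B_valuation: "valuation_ring_of B UNIV"
  unfolding valuation_ring_of_def
proof (intro conjI ballI impI Br subset_UNIV)
  fix x :: 'a
  define f where "f = (\<Prod>i<p. map_poly (\<sigma> ^^ i) [:-x, 1:])"
  have f1: "lead_coeff f = 1" unfolding f_def by (rule lead_coeff_norm) simp
  have f0: "poly f x = 0" unfolding f_def by (rule poly_norm_eq_0) simp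
  have fK: "coeff f n \<in> K" for n
  proof -
    have "map_poly \<sigma> f = f"
      unfolding f_def by (rule \<sigma>_prod_shift[where f = "\<lambda>i. map_poly (\<sigma> ^^ i) [:-x, 1:]"])
        (simp_all only: map_poly_map_poly \<sigma>_hom \<sigma>_p Gal_map_poly_prod[OF \<sigma>(1)] funpow_0 funpow.simps id_apply)
    thus ?thesis using fixed_field by (metis coeff_map_poly \<sigma>_hom(3))
  qed
  define S where "S = coeff f ` {..degree f} - {0}"
  have "lead_coeff f \<in> S" using f1 unfolding S_def by (intro DiffI imageI) auto
  hence "\<exists>a\<in>S. \<forall>b\<in>S. b / a \<in> A"
    by (intro valuation_ring_finite_dominant[OF A K]) (use fK in \<open>auto simp: S_def\<close>)
  then obtain a where a: "a \<in> S" "\<And>b. b \<in> S \<Longrightarrow> b / a \<in> A" by blast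
  from a(1) obtain k where "a = coeff f k" "a \<noteq> 0" unfolding S_def by blast
  with a(2) have k: "coeff f k \<noteq> 0" "\<And>j. j \<le> degree f \<Longrightarrow> coeff f j \<noteq> 0 \<Longrightarrow> coeff f j / coeff f k \<in> A"
    by (auto simp: S_def)
  define g where "g = smult (inverse (coeff f k)) f"
  have "coeff g j \<in> B" for j
  proof (cases "coeff f j = 0")
    case False
    hence "coeff f j / coeff f k \<in> A" using k(2) by (auto simp: le_degree)
    thus ?thesis using A_sub(2) by (simp add: g_def divide_inverse mult.commute)
  qed (use B_simps in \<open>simp add: g_def\<close>)
  moreover have "coeff g k = 1" "poly g x = 0" using k(1) f0 by (auto simp: g_def)
  ultimately show "x \<in> B \<or> inverse x \<in> B"
    using mB(2) by (intro B_valuation_aux[of g "degree g" x k]) (auto simp: polys_over_def)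
qed

end

section \<open>Approximation of the generator by elements of the base field\<close>

lemma map_poly_to_ac_add: "map_poly to_ac (f + g) = map_poly to_ac f + map_poly to_ac g"
  by (intro poly_eqI) (simp add: coeff_map_poly)

lemma map_poly_to_ac_const: "map_poly to_ac [:a:] = [:to_ac a:]"
  by (intro poly_eqI) (simp add: coeff_map_poly coeff_pCons split: nat.split)

lemma map_poly_to_ac_mult: "map_poly to_ac (f * g) = map_poly to_ac f * map_poly to_ac g"
  by (intro poly_eqI) (simp add: coeff_map_poly coeff_mult to_ac_sum)

lemma map_poly_to_ac_prod: "map_poly to_ac (prod f I) = (\<Prod>i\<in>I. map_poly to_ac (f i))"
  by (induction I rule: infinite_finite_induct) (auto simp: map_poly_to_ac_mult)

lemma poly_map_to_ac: "poly (map_poly to_ac f) (to_ac x) = to_ac (poly f x)"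
  by (induction f) (auto simp: map_poly_pCons)

lemma poly_map_to_ac_pcompose:
  "poly (map_poly to_ac (pcompose f g)) x = poly (map_poly to_ac f) (poly (map_poly to_ac g) x)"
  by (induction f) (auto simp: map_poly_pCons pcompose_pCons map_poly_to_ac_add map_poly_to_ac_mult map_poly_to_ac_const)

lemma polys_over_pcompose_ideal:
  assumes R: "is_subring R" and M: "0 \<in> M" "\<And>x y. x \<in> M \<Longrightarrow> y \<in> M \<Longrightarrow> x + y \<in> M"
      "\<And>x y. x \<in> M \<Longrightarrow> y \<in> R \<Longrightarrow> x * y \<in> M"
    and f: "f \<in> polys_over M" and g: "g \<in> polys_over R"
  shows "pcompose f g \<in> polys_over M"
  using f
proof (induction f)
  case 0
  then show ?case by simp
next
  case (pCons a f)
  have a: "a \<in> M" using polys_overD[OF pCons.prems, of 0] by simp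
  have "f \<in> polys_over M"
    using polys_overD[OF pCons.prems, of "Suc _"] by (intro polys_overI) simp
  hence "pcompose f g * g \<in> polys_over M"
    by (intro polys_over_ideal_mult[OF M _ g] pCons.IH)
  thus ?case
    using a M by (auto simp: pcompose_pCons polys_over_def coeff_pCons mult.commute split: nat.splits)
qed

section \<open>Polynomials invariant under translation by the prime field\<close>

context AS_galois
begin

lemma wp_poly_K: "wp_poly p \<in> polys_over K"
  unfolding wp_poly_def by (intro polys_K K_simps)

text \<open>Frobenius is additive, so only terms of degrees \<open>p\<close>, 1 and 0 survive. With
  \<open>a = \<rho> = 1\<close> this is translation invariance; a general \<rho> rescales around
  \<open>a\<close>.\<close>

lemma wp_poly_translate: "pcompose (wp_poly p) [:a, \<rho>:] = smult (\<rho> ^ p) (monom 1 p) - [:0, \<rho>:] + [:a ^ p - a:]"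
  for a \<rho> :: 'a
proof -
  have "[:a, \<rho>:] ^ p = ([:a:] + monom \<rho> 1) ^ p"
    by (simp add: monom_altdef)
  also have "\<dots> = [:a:] ^ p + monom \<rho> 1 ^ p"
    by (rule freshmans_dream) (use p in auto)
  also have "\<dots> = [:a ^ p:] + monom (\<rho> ^ p) p"
    by (simp add: monom_power poly_const_pow)
  finally have "[:a, \<rho>:] ^ p = [:a ^ p:] + monom (\<rho> ^ p) p" .
  moreover have "pcompose (monom 1 p) q = q ^ p" for q :: "'a poly"
    by (simp add: pcompose_altdef map_poly_monom poly_monom one_pCons [symmetric])
  ultimately show ?thesis
    by (simp add: wp_poly_def pcompose_diff pcompose_pCons smult_monom algebra_simps)
qed

lemma translation_invariant_const:
  fixes r :: "'a poly"
  assumes r: "pcompose r [:1, 1:] = r" "degree r < p"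
  shows "r = [:coeff r 0:]"
proof (rule poly_eqI_degree[where A = "of_nat ` {..<p}"])
  have "poly r (of_nat i) = poly r 0" for i
  proof (induction i)
    case (Suc i)
    have "poly r (of_nat (Suc i)) = poly (pcompose r [:1, 1:]) (of_nat i)" by (simp add: poly_pcompose)
    thus ?case using Suc r(1) by simp
  qed simp
  thus "poly r z = poly [:coeff r 0:] z" if "z \<in> of_nat ` {..<p}" for z
    using that by (auto simp: poly_0_coeff_0)
  show "degree r < card (of_nat ` {..<p} :: 'a set)" "degree [:coeff r 0:] < card (of_nat ` {..<p} :: 'a set)"
    using r(2) p_gt inj_on_of_nat_char[OF p(2)] by (simp_all add: card_image)
qed

text \<open>Expansion in powers of \<open>T^p - T\<close>: comparing degrees, quotient and remainder
  of an invariant polynomial are again invariant, so the remainder is constant and induction treats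
  the quotient.\<close>

lemma translation_invariant_poly:
  assumes "U \<in> polys_over K" "pcompose U [:1, 1:] = U"
  shows "\<exists>Q\<in>polys_over K. U = pcompose Q (wp_poly p)"
  using assms
proof (induction "degree U" arbitrary: U rule: less_induct)
  case (less U)
  let ?P = "wp_poly p :: 'a poly" and ?T = "\<lambda>f :: 'a poly. pcompose f [:1, 1:]"
  note wp = wp_poly_degree[OF p_gt(1), where 'a = 'a]
  have P0: "?P \<noteq> 0" using wp p_gt by auto
  have PT: "?T ?P = ?P"
    unfolding wp_poly_translate by (simp add: wp_poly_def)
  obtain q r where qr: "q \<in> polys_over K" "r \<in> polys_over K" "U = ?P * q + r" "r = 0 \<or> degree r < p"
    using polys_over_divmod_monic[OF Kr wp_poly_K wp(2) less.prems(1)] unfolding wp by blast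
  have rp: "degree r < p" using qr(4) p_gt by auto
  have "?P * ?T q + ?T r = ?P * q + r"
    using less.prems(2) unfolding qr(3) by (simp only: pcompose_add pcompose_mult PT)
  hence eq: "?P * (?T q - q) = r - ?T r" by (simp add: algebra_simps)
  have "degree (r - ?T r) < p"
    using rp by (intro degree_diff_less) (simp_all add: degree_pcompose)
  hence Tq: "?T q = q"
  proof (rule contrapos_pp)
    assume "?T q \<noteq> q"
    hence "degree (?P * (?T q - q)) \<ge> p" using P0 wp by (simp add: degree_mult_eq)
    thus "\<not> degree (r - ?T r) < p" by (simp add: eq)
  qed
  hence "?T r = r" using eq by simp
  hence r: "r = [:coeff r 0:]" by (rule translation_invariant_const[OF _ rp])
  obtain Q where Q: "Q \<in> polys_over K" "q = pcompose Q ?P"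
  proof (cases "q = 0")
    case True
    then show ?thesis using that[of 0] polys_K by simp
  next
    case False
    have "degree U = p + degree q"
      unfolding qr(3) using False P0 rp wp by (subst degree_add_eq_left) (auto simp: degree_mult_eq)
    hence "degree q < degree U" using p_gt by simp
    then show ?thesis using less.hyps[OF _ qr(1) Tq] that by blast
  qed
  have "U = pcompose (pCons (coeff r 0) Q) ?P"
    using r qr(3) Q(2) by (simp add: pcompose_pCons add.commute)
  thus ?case using Q(1) polys_overD[OF qr(2)] polys_K(7) by blast
qed

text \<open>Replacing \<open>T\<close> by \<open>T + 1\<close> permutes the factors cyclically. At
  \<open>\<theta>^p - \<theta>\<close> the polynomial \<open>Q\<close> takes the value
  \<open>N(g(\<theta>))\<close>.\<close>

lemma norm_poly_factors:
  assumes g: "g \<in> polys_over K"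
  obtains Q where "Q \<in> polys_over K"
    "(\<Prod>i<p. pcompose g [:of_nat i, 1:]) = pcompose Q (wp_poly p)"
proof -
  define U where "U = (\<Prod>i<p. pcompose g [:of_nat i, 1:])"
  have "U \<in> polys_over K"
    unfolding U_def by (intro polys_over_prod[OF Kr] polys_K g K_simps)
  moreover have "pcompose U [:1, 1:] = U"
    unfolding U_def
  proof (rule \<sigma>_prod_shift[where f = "\<lambda>i. pcompose g [:of_nat i, 1:]"])
    show "pcompose (pcompose g [:of_nat i, 1:]) [:1, 1:] = pcompose g [:of_nat (Suc i), 1:]" for i
      by (simp add: pcompose_assoc [symmetric] pcompose_pCons add.commute)
  qed (simp_all add: pcompose_prod of_nat_p)
  ultimately show thesis using translation_invariant_poly that by (auto simp: U_def)
qed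

text \<open>A common root of \<open>T\<^sup>p - T - h\<close> and \<open>\<Prod>g(T + i)\<close> exists in the algebraic closure of \<open>L\<close>, and up
  to an integer it is also a root of \<open>g\<close>, hence lies in \<open>K\<close>.\<close>

lemma norm_poly_root:
  assumes g: "g \<in> polys_over K" "g \<noteq> 0" "degree g < p"
    and Q: "(\<Prod>i<p. pcompose g [:of_nat i, 1:]) = pcompose Q (wp_poly p)"
    and h: "h \<in> K" "poly Q h = 0"
  shows "\<exists>c\<in>K. c ^ p - c = h"
proof -
  \<comment> \<open>The roots of \<open>T^p - T - h\<close> may lie outside \<open>L\<close>, so the
    argument runs over the copy \<open>K'\<close> of \<open>K\<close> in the algebraic
    closure.\<close>
  define K' where "K' = to_ac ` K"
  have K': "is_subfield K'"
    using K unfolding is_subfield_def K'_def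
    by (auto simp flip: to_ac_add to_ac_diff to_ac_mult to_ac_inverse intro: image_eqI[of _ _ 0] image_eqI[of _ _ 1])
  have p': "prime p" "CHAR('a alg_closure) = p" using p by auto
  define F where "F = map_poly to_ac (wp_poly p - [:h:])"
  have "degree (wp_poly p - [:h:]) = p"
    using wp_poly_degree[OF p_gt(1), where 'a = 'a] p_gt
    by (subst diff_conv_add_uminus, subst degree_add_eq_left) auto
  hence "degree F > 0" unfolding F_def using p_gt by (simp add: Polynomial.degree_map_poly)
  then obtain \<eta> where "poly F \<eta> = 0" using alg_closed_imp_poly_has_root by blast
  hence \<eta>: "\<eta> ^ p - \<eta> = to_ac h"
  proof -
    have "F = monom 1 p - [:to_ac h, 1:]"
      by (intro poly_eqI) (auto simp: F_def wp_poly_def coeff_map_poly coeff_pCons coeff_monom split: nat.splits)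
    hence "poly F \<eta> = \<eta> ^ p - (to_ac h + \<eta>)" by (simp only: poly_diff poly_monom) simp
    thus ?thesis using \<open>poly F \<eta> = 0\<close> by (simp add: algebra_simps)
  qed
  have wp': "map_poly to_ac (wp_poly p) = (wp_poly p :: 'a alg_closure poly)"
    by (intro poly_eqI) (auto simp: wp_poly_def coeff_map_poly coeff_pCons coeff_monom split: nat.splits)
  have "poly (map_poly to_ac (pcompose Q (wp_poly p))) \<eta> = 0"
    by (simp add: poly_map_to_ac_pcompose wp' \<eta> poly_map_to_ac h)
  hence "(\<Prod>i<p. poly (map_poly to_ac g) (\<eta> + of_nat i)) = 0"
    by (simp add: Q [symmetric] map_poly_to_ac_prod poly_prod poly_map_to_ac_pcompose map_poly_pCons add.commute)
  then obtain i where i: "i < p" "poly (map_poly to_ac g) (\<eta> + of_nat i) = 0"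
    by (auto simp: prod_zero_iff)
  have \<eta>i: "(\<eta> + of_nat i) ^ p - (\<eta> + of_nat i) = to_ac h"
    using AS_roots[OF p', of "\<eta> + of_nat i" \<eta>] i(1) \<eta> by auto
  have "\<eta> + of_nat i \<in> K'"
  proof (rule AS_root_in_subfield[OF p' K' _ _ _ _ i(2)])
    show "map_poly to_ac g \<in> polys_over K'"
      using g(1) by (auto simp: polys_over_def coeff_map_poly K'_def)
    show "map_poly to_ac g \<noteq> 0" using g(2) by (simp add: map_poly_eq_0_iff)
    show "degree (map_poly to_ac g) < p" using g(3) by (simp add: Polynomial.degree_map_poly)
  qed (use h in \<open>auto simp: \<eta>i K'_def\<close>)
  then obtain c where c: "c \<in> K" "\<eta> + of_nat i = to_ac c" by (auto simp: K'_def)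
  have "to_ac (c ^ p - c) = to_ac h" using \<eta>i by (simp add: c(2))
  thus ?thesis using c(1) by (auto simp del: to_ac_diff)
qed

end

text \<open>Hensel's lemma for a polynomial \<open>f\<close> that need not be monic: the reversed polynomial, rescaled
  by \<open>T = - f\<^sub>0 / V\<close>, is monic with simple root \<open>V = 1\<close> modulo the maximal ideal.\<close>

lemma henselian_linear_reduction:
  assumes A: "is_subring A" and add: "\<And>x y. x \<in> max_ideal A \<Longrightarrow> y \<in> max_ideal A \<Longrightarrow> x + y \<in> max_ideal A"
    and hensel: "henselian A"
    and f: "f \<in> polys_over A" "coeff f 1 = 1" "\<And>j. j \<ge> 2 \<Longrightarrow> coeff f j \<in> max_ideal A"
  shows "\<exists>y\<in>A. poly f y = 0"
proof -
  note AA = is_subringD[OF A] subring_power[OF A] subring_of_nat[OF A]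
  note mA = max_ideal_basic[OF A]
  define n where "n = degree f"
  have n: "n \<ge> 1" using f(2) by (auto simp: n_def intro!: le_degree)
  define a where "a = coeff f 0"
  have aA: "a \<in> A" using polys_overD[OF f(1)] by (simp add: a_def)
  define c where "c j = coeff f j * (- 1) ^ j * a ^ (j - 1)" for j
  have c: "c j \<in> max_ideal A" if "j \<ge> 2" for j
    unfolding c_def by (intro mA(5) f(3) that AA aA)
  \<comment> \<open>\<open>a * g(V) = V^n f(-a / V)\<close>. The division by \<open>a\<close> takes
    place inside the \<open>c j\<close>, so that \<open>a = 0\<close> is covered.\<close>
  define g where "g = monom 1 n - monom 1 (n - 1) + (\<Sum>j\<in>{2..n}. monom (c j) (n - j))"
  have gA: "g \<in> polys_over A"
  proof -
    have "c j \<in> A" if "j \<in> {2..n}" for j using c that mA(3) by auto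
    hence "(\<Sum>j\<in>{2..n}. monom (c j) (n - j)) \<in> polys_over A"
      by (intro polys_overI) (auto simp: coeff_sum coeff_monom intro!: subring_sum[OF A] AA)
    thus ?thesis unfolding g_def by (intro polys_over_closed[OF A] AA)
  qed
  have cg: "coeff g k = (if k = n then 1 else 0)" if "k \<ge> n" for k
  proof -
    have "(\<Sum>j\<in>{2..n}. coeff (monom (c j) (n - j)) k) = 0"
      using that n by (intro sum.neutral) (auto simp: coeff_monom)
    thus ?thesis using that n by (auto simp: g_def coeff_sum coeff_monom)
  qed
  have "degree g = n"
    by (rule antisym[OF degree_le le_degree]) (auto simp: cg)
  hence lg: "lead_coeff g = 1" by (simp add: cg)
  have msum: "sum h I \<in> max_ideal A" if "\<And>i. i \<in> I \<Longrightarrow> h i \<in> max_ideal A" for h and I :: "nat set"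
    using that by (induction I rule: infinite_finite_induct) (auto intro: mA(1) add)
  have g1: "poly g 1 \<in> max_ideal A"
  proof -
    have "poly g 1 = (\<Sum>j\<in>{2..n}. c j)"
      by (simp add: g_def poly_sum poly_monom)
    thus ?thesis using msum[of "{2..n}" c] c by auto
  qed
  \<comment> \<open>Modulo the maximal ideal only \<open>T^n - T^(n-1)\<close> is left, whose
    derivative at 1 is \<open>n - (n - 1) = 1\<close>.\<close>
  have g2: "poly (pderiv g) 1 \<notin> max_ideal A"
  proof
    assume m: "poly (pderiv g) 1 \<in> max_ideal A"
    define S where "S = (\<Sum>j\<in>{2..n}. of_nat (n - j) * c j)"
    have "S \<in> max_ideal A"
      unfolding S_def by (intro msum mA(4) c AA) auto
    have "pderiv (\<Sum>j\<in>{2..n}. monom (c j) (n - j)) = (\<Sum>j\<in>{2..n}. pderiv (monom (c j) (n - j)))"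
      by (induction "{2..n}" rule: infinite_finite_induct) (simp_all add: pderiv_sum)
    hence "poly (pderiv g) 1 = of_nat n - of_nat (n - 1) + S"
      by (simp add: g_def pderiv_add pderiv_diff pderiv_monom poly_monom poly_sum S_def)
    also have "of_nat n - of_nat (n - 1) = (1::'a)" using n by (simp add: of_nat_diff)
    finally have "1 = poly (pderiv g) 1 + - S" by simp
    also have "\<dots> \<in> max_ideal A" by (intro add m mA(6) \<open>S \<in> _\<close>)
    finally show False using mA(2) by contradiction
  qed
  obtain V where V: "V \<in> A" "poly g V = 0" "V - 1 \<in> max_ideal A"
    using hensel gA lg g1 g2 AA(2) unfolding henselian_def polys_over_def by blast
  have Vm: "V \<notin> max_ideal A"
  proof
    assume "V \<in> max_ideal A"
    hence "V + - (V - 1) \<in> max_ideal A" by (intro add mA(6) V)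
    thus False using mA(2) by simp
  qed
  hence V0: "V \<noteq> 0" "inverse V \<in> A" using V(1) by (auto simp: max_ideal_iff)
  define y where "y = - a * inverse V"
  have yA: "y \<in> A" unfolding y_def by (intro AA aA V0)
  have term_eq: "coeff f j * y ^ j * V ^ n = a * (c j * V ^ (n - j))" if j: "j \<in> {2..n}" for j
  proof -
    have "V ^ n = V ^ j * V ^ (n - j)" using j by (simp flip: power_add)
    moreover have "a ^ j = a * a ^ (j - 1)" using j by (cases j) auto
    moreover have "inverse V ^ j * V ^ j = 1" using V0 by (simp flip: power_mult_distrib)
    moreover have "y ^ j = (- 1) ^ j * a ^ j * inverse V ^ j"
      by (simp add: y_def power_minus[of "a * inverse V"] power_mult_distrib)
    ultimately show ?thesis by (simp add: c_def mult_ac)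
  qed
  have "{..n} = {0, 1} \<union> {2..n}" using n by auto
  hence "poly f y = (\<Sum>j\<in>{0, 1} \<union> {2..n}. coeff f j * y ^ j)"
    by (simp add: poly_altdef n_def)
  also have "\<dots> = a + y + (\<Sum>j\<in>{2..n}. coeff f j * y ^ j)"
    using f(2) by (subst sum.union_disjoint) (auto simp: a_def)
  finally have "poly f y * V ^ n = a * V ^ n + y * V ^ n + (\<Sum>j\<in>{2..n}. coeff f j * y ^ j * V ^ n)"
    by (simp add: distrib_right sum_distrib_right)
  also have "y * V ^ n = - a * V ^ (n - 1)"
    using n V0 by (cases n) (auto simp: y_def)
  also have "(\<Sum>j\<in>{2..n}. coeff f j * y ^ j * V ^ n) = a * (\<Sum>j\<in>{2..n}. c j * V ^ (n - j))"
    unfolding sum_distrib_left by (intro sum.cong term_eq) auto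
  also have "a * V ^ n + - a * V ^ (n - 1) + a * (\<Sum>j\<in>{2..n}. c j * V ^ (n - j)) = a * poly g V"
    by (simp add: g_def poly_monom poly_sum algebra_simps)
  finally have "poly f y = 0" using V(2) V0 by simp
  with yA show ?thesis by blast
qed

section \<open>Absolute values and polynomial congruences in the extension\<close>

context AS_valued
begin

lemma mB_or: "x \<notin> B \<Longrightarrow> inverse x \<in> max_ideal B"
  using valuation_ringD(4)[OF B_valuation] by auto

lemma not_mB: "x \<notin> max_ideal B \<Longrightarrow> inverse x \<in> B"
  using mB_or[of x] mB(3) by (cases "x \<in> B") (auto simp: max_ideal_iff)

lemma mB_K: "x \<in> max_ideal B \<Longrightarrow> x \<in> K \<Longrightarrow> x \<in> max_ideal A"
  using BK_A A_sub(2) by (auto simp: max_ideal_iff)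

lemma norm_\<sigma>n: "norm_LK K ((\<sigma> ^^ n) x) = norm_LK K x"
proof -
  have "norm_LK K ((\<sigma> ^^ n) x) = (\<sigma> ^^ n) (norm_LK K x)"
    by (simp add: norm_eq Gal_prod[OF \<sigma>n_Gal] funpow_add [THEN fun_cong, unfolded o_def, symmetric] add.commute)
  thus ?thesis by (simp add: \<sigma>n_hom(12)[OF norm_in_K])
qed

text \<open>\<sigma> preserves absolute values: both quotients have norm 1, and an element outside
  \<open>B\<close> cannot have norm 1, because the norm of its inverse lies in the maximal
  ideal.\<close>

lemma \<sigma>n_ratio:
  assumes "x \<noteq> 0"
  shows "(\<sigma> ^^ n) x / x \<in> B" "x / (\<sigma> ^^ n) x \<in> B"
proof -
  have *: "z \<in> B" if z: "norm_LK K z = 1" for z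
  proof (rule ccontr)
    assume "z \<notin> B"
    hence m: "inverse z \<in> max_ideal B" by (rule mB_or)
    have "{..<p} = insert 0 {1..<p}" using p_gt by auto
    hence "norm_LK K (inverse z) = inverse z * (\<Prod>i\<in>{1..<p}. (\<sigma> ^^ i) (inverse z))"
      by (simp add: norm_eq)
    also have "\<dots> \<in> max_ideal B"
      by (intro mB(5) m subring_prod[OF Br] \<sigma>n_B mB(3))
    finally have "norm_LK K (inverse z) \<in> max_ideal B" .
    moreover have "z \<noteq> 0" using z norm_zero_iff[of 0] by auto
    hence "norm_LK K z * norm_LK K (inverse z) = 1"
      using norm_K[OF K_simps(2)] by (simp flip: norm_mult)
    ultimately show False using z mB(2) by simp
  qed
  have "norm_LK K x \<noteq> 0" using assms norm_zero_iff by simp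
  thus "(\<sigma> ^^ n) x / x \<in> B" "x / (\<sigma> ^^ n) x \<in> B"
    by (auto intro!: * simp: norm_divide norm_\<sigma>n)
qed

text \<open>The norm is an element of \<open>K\<close> with the absolute value of
  \<open>x^p\<close>; it replaces \<open>\<rho>^p\<close> where coefficients must lie in
  \<open>K\<close>.\<close>

lemma norm_ratio:
  assumes "x \<noteq> 0"
  shows "norm_LK K x / x ^ p \<in> B" "x ^ p / norm_LK K x \<in> B"
proof -
  have "norm_LK K x / x ^ p = (\<Prod>i<p. (\<sigma> ^^ i) x / x)"
    by (simp add: norm_eq prod_dividef)
  thus "norm_LK K x / x ^ p \<in> B"
    using \<sigma>n_ratio(1)[OF assms] by (auto intro: subring_prod[OF Br])
  have "x ^ p / norm_LK K x = (\<Prod>i<p. x / (\<sigma> ^^ i) x)"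
    by (simp add: norm_eq prod_dividef)
  thus "x ^ p / norm_LK K x \<in> B"
    using \<sigma>n_ratio(2)[OF assms] by (auto intro: subring_prod[OF Br])
qed

abbreviation mB_polys :: "'a poly set" where "mB_polys \<equiv> polys_over (max_ideal B)"

lemma mB_polys_add: "f \<in> mB_polys \<Longrightarrow> g \<in> mB_polys \<Longrightarrow> f + g \<in> mB_polys"
  and mB_polys_diff: "f \<in> mB_polys \<Longrightarrow> g \<in> mB_polys \<Longrightarrow> f - g \<in> mB_polys"
  by (auto simp: polys_over_def intro: mB_add mB_diff)

lemma mB_polys_mult: "f \<in> mB_polys \<Longrightarrow> g \<in> polys_over B \<Longrightarrow> f * g \<in> mB_polys"
  by (rule polys_over_ideal_mult) (auto intro: mB mB_add)

lemma mB_polys_pcompose: "f \<in> mB_polys \<Longrightarrow> g \<in> polys_over B \<Longrightarrow> pcompose f g \<in> mB_polys"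
  by (rule polys_over_pcompose_ideal[OF Br]) (auto intro: mB mB_add)

lemma mB_polys_B: "f \<in> mB_polys \<Longrightarrow> f \<in> polys_over B"
  by (auto simp: polys_over_def mB)

lemma mB_polys_prod_cong:
  assumes "\<And>i. i \<in> I \<Longrightarrow> f i - g i \<in> mB_polys" "\<And>i. i \<in> I \<Longrightarrow> g i \<in> polys_over B"
  shows "prod f I - prod g I \<in> mB_polys"
  using assms
proof (induction I rule: infinite_finite_induct)
  case (insert i I)
  have g: "prod g I \<in> polys_over B" by (intro polys_over_prod[OF Br] insert) auto
  have fi: "f i \<in> polys_over B"
    using polys_B(3)[OF mB_polys_B[OF insert.prems(1)[of i]] insert.prems(2)[of i]] by simp
  have "(prod f I - prod g I) * f i + (f i - g i) * prod g I \<in> mB_polys"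
    using insert fi g by (intro mB_polys_add mB_polys_mult) auto
  thus ?case using insert by (simp add: algebra_simps)
qed (simp_all add: polys_over_def mB)

text \<open>Composition with a nonconstant monic polynomial preserves leading coefficients. So the
  leading coefficient of \<open>f\<close> is in the maximal ideal, and its leading term can be
  removed.\<close>

lemma mB_polys_pcompose_cancel:
  assumes E: "E \<in> polys_over B" "lead_coeff E = 1" "degree E > 0"
    and "pcompose f E \<in> mB_polys"
  shows "f \<in> mB_polys"
  using assms(4)
proof (induction "degree f" arbitrary: f rule: less_induct)
  case (less f)
  define a where "a = lead_coeff f"
  have "lead_coeff (pcompose f E) = a"
    unfolding a_def using lead_coeff_comp[OF E(3), of f] E(2) by simp
  hence am: "a \<in> max_ideal B" using polys_overD[OF less.prems] by metis
  show ?case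
  proof (cases "degree f = 0")
    case True
    then obtain b where "f = [:b:]" by (auto elim: degree_eq_zeroE)
    thus ?thesis using am mB(1) by (auto simp: a_def polys_over_def coeff_pCons split: nat.splits)
  next
    case False
    define f' where "f' = f - monom a (degree f)"
    have "degree f' < degree f"
      unfolding f'_def using False by (intro degree_lessI) (auto simp: a_def coeff_monom coeff_eq_0 le_less)
    moreover have "pcompose f' E \<in> mB_polys"
    proof -
      have "monom a (degree f) \<in> mB_polys"
        using am mB(1) by (auto simp: polys_over_def coeff_monom)
      thus ?thesis
        unfolding f'_def pcompose_diff by (intro mB_polys_diff less.prems mB_polys_pcompose E)
    qed
    ultimately have "f' \<in> mB_polys" by (rule less.hyps)
    hence "coeff f' n \<in> max_ideal B" for n by (rule polys_overD)
    hence "coeff f' n + (if n = degree f then a else 0) \<in> max_ideal B" for n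
      using am mB(1) by (intro mB_add) auto
    moreover have "coeff f' n + (if n = degree f then a else 0) = coeff f n" for n
      by (simp add: f'_def coeff_monom)
    ultimately show ?thesis by (intro polys_overI) metis
  qed
qed

text \<open>Up to units, \<open>g (\<theta> + \<rho> T)\<close> reduces to a linear polynomial, so \<open>g\<close> ought to have a root at distance
  at most \<open>\<rho>\<close> from \<open>\<theta>\<close>. Its norm \<open>\<Prod>g(T + i) = Q (T\<^sup>p - T)\<close> yields a polynomial \<open>Q\<close> over \<open>K\<close> which
  likewise reduces to a linear polynomial after scaling, and Hensel's lemma over \<open>A\<close> applies to it.\<close>

lemma approximation_of_linear_reduction:
  assumes \<rho>: "\<rho> \<noteq> 0" "inverse \<rho> \<in> B"
    and g: "g \<in> polys_over K" "degree g < p"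
    and G_def: "G = pcompose g [:\<theta>, \<rho>:]"
    and G: "coeff G 1 \<noteq> 0" "coeff G 0 / coeff G 1 \<in> B" "\<And>j. j \<ge> 2 \<Longrightarrow> coeff G j / coeff G 1 \<in> max_ideal B"
  shows "\<exists>c\<in>K. (\<theta> - c) / \<rho> \<in> B"
proof -
  define h where "h = \<theta> ^ p - \<theta>"
  have hK: "h \<in> K" using \<theta> by (simp add: h_def)
  have g0: "g \<noteq> 0" using G(1) G_def by auto
  obtain Q where Q: "Q \<in> polys_over K" "(\<Prod>i<p. pcompose g [:of_nat i, 1:]) = pcompose Q (wp_poly p)"
    using norm_poly_factors[OF g(1)] by blast
  \<comment> \<open>Chosen so that substituting \<open>\<theta> + \<rho> T\<close> turns
    \<open>T^p - T\<close> into \<open>h + \<rho>^p E(T)\<close> with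
    \<open>E = T^p - \<epsilon> T\<close> monic and integral.\<close>
  define \<epsilon> where "\<epsilon> = inverse \<rho> ^ (p - 1)"
  have \<epsilon>: "\<epsilon> \<in> B" unfolding \<epsilon>_def by (intro B_simps \<rho>)
  have \<rho>\<epsilon>: "\<rho> ^ p * \<epsilon> = \<rho>"
    using \<rho>(1) p_gt by (cases p) (auto simp: \<epsilon>_def power_inverse)
  define E where "E = monom 1 p - [:0, \<epsilon>:]"
  have E: "E \<in> polys_over B" "lead_coeff E = 1" "degree E > 0"
  proof -
    show "E \<in> polys_over B" unfolding E_def by (intro polys_B B_simps \<epsilon>)
    have "degree (- [:0, \<epsilon>:]) < degree (monom (1 :: 'a) p)"
      by (rule le_less_trans[of _ 1]) (use p_gt in \<open>simp_all add: degree_monom_eq\<close>)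
    hence deg: "degree E = p"
      unfolding E_def diff_conv_add_uminus by (subst degree_add_eq_left) (simp_all add: degree_monom_eq)
    thus "degree E > 0" using p_gt by simp
    show "lead_coeff E = 1"
      unfolding deg using p_gt by (simp add: E_def coeff_pCons coeff_eq_0 split: nat.splits)
  qed
  have wpE: "pcompose (wp_poly p) [:a, \<rho>:] = smult (\<rho> ^ p) E + [:a ^ p - a:]" for a
    unfolding wp_poly_translate E_def by (simp add: smult_diff_right \<rho>\<epsilon>)
  define Qh where "Qh = pcompose Q [:h, 1:]"
  have Qh: "Qh \<in> polys_over K" unfolding Qh_def by (intro polys_K Q hK K_simps)
  \<comment> \<open>\<open>D(T) = Q(h + \<rho>^p T)\<close>, so \<open>D(E(T))\<close> is the
    product of the translates \<open>G(T + i / \<rho>)\<close>.\<close>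
  define D where "D = pcompose Qh [:0, \<rho> ^ p:]"
  define G1 where "G1 = coeff G 1"
  have G10: "G1 \<noteq> 0" using G(1) by (simp add: G1_def)
  define w where "w = coeff G 0 / G1"
  have wB: "w \<in> B" using G(2) by (simp add: w_def G1_def)
  have DE: "pcompose D E = (\<Prod>i<p. pcompose G [:of_nat i / \<rho>, 1:])"
  proof -
    have "pcompose D E = pcompose Q (smult (\<rho> ^ p) E + [:h:])"
      by (simp add: D_def Qh_def pcompose_assoc [symmetric] pcompose_pCons add.commute)
    also have "\<dots> = pcompose Q (pcompose (wp_poly p) [:\<theta>, \<rho>:])"
      by (simp add: wpE h_def)
    also have "\<dots> = (\<Prod>i<p. pcompose (pcompose g [:of_nat i, 1:]) [:\<theta>, \<rho>:])"
      by (simp add: pcompose_assoc Q(2) [symmetric] pcompose_prod)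
    also have "\<dots> = (\<Prod>i<p. pcompose G [:of_nat i / \<rho>, 1:])"
      using \<rho>(1) by (simp add: G_def pcompose_assoc [symmetric] pcompose_pCons add.commute)
    finally show ?thesis .
  qed
  define w' where "w' = w ^ p - \<epsilon> * w"
  have w'B: "w' \<in> B" unfolding w'_def by (intro B_simps wB \<epsilon>)
  have lin: "(\<Prod>i<p. [:w + of_nat i / \<rho>, 1:]) = E + [:w':]"
  proof -
    have "(\<Prod>i<p. [:w + of_nat i / \<rho>, 1:]) = (\<Prod>i<p. smult (1 / \<rho>) (pcompose [:of_nat i, 1:] [:\<rho> * w, \<rho>:]))"
      using \<rho>(1) by (intro prod.cong) (auto simp: pcompose_pCons field_simps)
    also have "\<dots> = smult ((1 / \<rho>) ^ p) (pcompose (wp_poly p) [:\<rho> * w, \<rho>:])"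
      by (simp only: prod_smult pcompose_prod [symmetric] prod_linear_of_nat[OF p] prod_constant card_lessThan)
    also have "\<dots> = E + [:((\<rho> * w) ^ p - \<rho> * w) / \<rho> ^ p:]"
      using \<rho>(1) by (simp add: wpE smult_add_right power_divide)
    also have "((\<rho> * w) ^ p - \<rho> * w) / \<rho> ^ p = w'"
    proof -
      have "(\<rho> * w) ^ p - \<rho> * w = \<rho> ^ p * w'"
        by (simp add: w'_def power_mult_distrib right_diff_distrib mult.assoc [symmetric] \<rho>\<epsilon>)
      thus ?thesis using \<rho>(1) by simp
    qed
    finally show ?thesis .
  qed
  define D' where "D' = smult (1 / G1 ^ p) D"
  have D'E: "pcompose D' E = (\<Prod>i<p. pcompose (smult (1 / G1) G) [:of_nat i / \<rho>, 1:])"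
    by (simp add: D'_def pcompose_smult DE prod_smult power_divide)
  have iB: "of_nat i / \<rho> \<in> B" for i
    unfolding divide_inverse by (intro B_simps \<rho>)
  \<comment> \<open>The two products are congruent factor by factor. Cancelling \<open>E\<close>
    leaves \<open>D'\<close> congruent to \<open>T + w'\<close>, which is linear.\<close>
  have "pcompose D' E - (E + [:w':]) \<in> mB_polys"
    unfolding D'E lin [symmetric]
  proof (rule mB_polys_prod_cong)
    fix i assume "i \<in> {..<p}"
    have "smult (1 / G1) G - [:w, 1:] \<in> mB_polys"
    proof (rule polys_overI)
      fix j
      consider "j = (0::nat)" | "j = 1" | "j \<ge> 2" by linarith
      thus "coeff (smult (1 / G1) G - [:w, 1:]) j \<in> max_ideal B"
        using G(3)[of j] G10 mB(1) by cases (auto simp: w_def G1_def coeff_pCons split: nat.splits)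
    qed
    moreover have iP: "[:of_nat i / \<rho>, 1:] \<in> polys_over B" by (intro polys_B B_simps iB)
    ultimately have "pcompose (smult (1 / G1) G - [:w, 1:]) [:of_nat i / \<rho>, 1:] \<in> mB_polys"
      by (rule mB_polys_pcompose)
    thus "pcompose (smult (1 / G1) G) [:of_nat i / \<rho>, 1:] - [:w + of_nat i / \<rho>, 1:] \<in> mB_polys"
      by (simp add: pcompose_diff pcompose_pCons)
    show "[:w + of_nat i / \<rho>, 1:] \<in> polys_over B" by (intro polys_B B_simps iB wB)
  qed
  moreover have "pcompose D' E - (E + [:w':]) = pcompose (D' - [:w', 1:]) E"
    by (simp add: pcompose_diff pcompose_pCons add.commute)
  ultimately have D'lin: "D' - [:w', 1:] \<in> mB_polys"
    by (simp only: mB_polys_pcompose_cancel[OF E])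
  define q where "q = coeff Qh"
  have qK: "q j \<in> K" for j using polys_overD[OF Qh] by (simp add: q_def)
  define d where "d = coeff D'"
  have d: "d j = q j * (\<rho> ^ p) ^ j / G1 ^ p" for j
    by (simp add: d_def D'_def D_def coeff_pcompose_linear q_def)
  have d0: "d 0 \<in> B" and d1: "d 1 - 1 \<in> max_ideal B" and dj: "\<And>j. j \<ge> 2 \<Longrightarrow> d j \<in> max_ideal B"
  proof -
    have "d 0 - w' \<in> max_ideal B" using polys_overD[OF D'lin, of 0] by (simp add: d_def)
    hence "(d 0 - w') + w' \<in> B" by (intro B_simps(3) mB(3) w'B)
    thus "d 0 \<in> B" by simp
    show "d 1 - 1 \<in> max_ideal B" using polys_overD[OF D'lin, of 1] by (simp add: d_def)
    show "d j \<in> max_ideal B" if "j \<ge> 2" for j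
      using polys_overD[OF D'lin, of j] that by (auto simp: d_def coeff_pCons split: nat.splits)
  qed
  have "d 1 \<notin> max_ideal B"
  proof
    assume "d 1 \<in> max_ideal B"
    from mB_diff[OF this d1] mB(2) show False by simp
  qed
  moreover have "d 1 \<in> B" using B_simps(3)[OF mB(3)[OF d1] B_simps(2)] by simp
  ultimately have d1': "d 1 \<noteq> 0" "inverse (d 1) \<in> B" by (auto simp: max_ideal_iff)
  hence q1: "q 1 \<noteq> 0" using d[of 1] by auto
  \<comment> \<open>Scaling by the norm \<open>n\<close> instead of \<open>\<rho>^p\<close> keeps
    the polynomial over \<open>K\<close>; the two differ by the unit \<open>\<kappa>\<close>, so the
    reduction stays linear.\<close>
  define n where "n = norm_LK K \<rho>"
  have nK: "n \<in> K" and n0: "n \<noteq> 0"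
    using norm_in_K norm_zero_iff \<rho>(1) by (auto simp: n_def)
  define \<kappa> where "\<kappa> = n / \<rho> ^ p"
  have \<kappa>: "\<kappa> \<in> B" "inverse \<kappa> \<in> B" "\<kappa> \<noteq> 0"
    using norm_ratio[OF \<rho>(1)] n0 \<rho>(1) by (auto simp: \<kappa>_def n_def)
  have n_eq: "n = \<kappa> * \<rho> ^ p" using \<rho>(1) by (simp add: \<kappa>_def)
  define f where "f = smult (1 / (q 1 * n)) (pcompose Qh [:0, n:])"
  have fj: "coeff f j = q j * n ^ j / (q 1 * n)" for j
    by (simp add: f_def coeff_pcompose_linear q_def)
  have fK: "coeff f j \<in> K" for j
    unfolding fj by (intro K_simps qK nK)
  have f_d: "coeff f j = d j * inverse (d 1) * (\<kappa> ^ j * inverse \<kappa>)" for j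
    using q1 G10 \<rho>(1) \<kappa>(3) unfolding fj d n_eq by (simp add: field_simps power_mult_distrib)
  have f1: "coeff f 1 = 1" using q1 n0 by (simp add: fj)
  have fm: "coeff f j \<in> max_ideal A" if "j \<ge> 2" for j
  proof (rule mB_K[OF _ fK])
    show "coeff f j \<in> max_ideal B"
      unfolding f_d by (intro mB(5) dj that B_simps d1' \<kappa>)
  qed
  have fA: "f \<in> polys_over A"
  proof (rule polys_overI, rule BK_A[OF _ fK])
    fix j
    consider "j = (0::nat)" | "j = 1" | "j \<ge> 2" by linarith
    thus "coeff f j \<in> B"
    proof cases
      case 1
      show ?thesis unfolding f_d 1 by (intro B_simps d0 d1' \<kappa>)
    next
      case 3
      then show ?thesis using fm mA(3) A_sub(2) by blast
    qed (use f1 B_simps in simp)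
  qed
  obtain y where y: "y \<in> A" "poly f y = 0"
    using henselian_linear_reduction[OF Ar mA(7) hensel fA f1 fm] by blast
  have "poly Q (h + n * y) = 0"
    using y(2) q1 n0 by (simp add: f_def poly_pcompose Qh_def mult.commute)
  moreover have "h + n * y \<in> K" by (intro K_simps hK nK A_sub y)
  ultimately obtain c where c: "c \<in> K" "c ^ p - c = h + n * y"
    using norm_poly_root[OF g(1) g0 g(2) Q(2)] by blast
  \<comment> \<open>Subtracting the equations of \<theta> and \<open>c\<close> and dividing by
    \<open>\<rho>^p\<close> gives \<open>E(z) + \<kappa> y = 0\<close>, an integral equation for
    \<open>z\<close>.\<close>
  define z where "z = (\<theta> - c) / \<rho>"
  have "z \<in> B"
  proof (rule B_integrally_closed)
    show "E + [:\<kappa> * y:] \<in> polys_over B"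
      by (intro polys_B E B_simps \<kappa> A_sub y)
    have "degree (E + [:\<kappa> * y:]) = degree E"
      by (rule degree_add_eq_left) (use E(3) in simp)
    thus "lead_coeff (E + [:\<kappa> * y:]) = 1"
      using E(2,3) by (simp add: coeff_pCons split: nat.splits)
    have "(\<theta> - c + c) ^ p = (\<theta> - c) ^ p + c ^ p"
      by (rule freshmans_dream) (use p in auto)
    hence "(\<theta> - c) ^ p - (\<theta> - c) = - (n * y)"
      using c(2) by (simp add: h_def algebra_simps)
    moreover have "\<rho> * z = \<theta> - c" using \<rho>(1) by (simp add: z_def)
    moreover have "\<rho> ^ p * (z ^ p - \<epsilon> * z) = (\<rho> * z) ^ p - (\<rho> ^ p * \<epsilon>) * z"
      by (simp add: power_mult_distrib right_diff_distrib mult.assoc)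
    ultimately have "\<rho> ^ p * (z ^ p - \<epsilon> * z) = - (n * y)"
      by (simp only: \<rho>\<epsilon>)
    hence "\<rho> ^ p * (z ^ p - \<epsilon> * z + \<kappa> * y) = 0"
      by (simp add: n_eq distrib_left mult_ac)
    hence "z ^ p - \<epsilon> * z + \<kappa> * y = 0" using \<rho>(1) by simp
    thus "poly (E + [:\<kappa> * y:]) z = 0"
      by (simp add: E_def poly_monom mult.commute)
  qed
  thus ?thesis using c(1) unfolding z_def by blast
qed

text \<open>By Fermat's little theorem the inverse of \<open>k\<close> is \<open>k^(p - 2)\<close>;
  the exponent appears as \<open>r\<close>.\<close>

lemma inverse_of_nat_B: "k > 0 \<Longrightarrow> k < p \<Longrightarrow> of_nat k \<noteq> (0::'a) \<and> inverse (of_nat k :: 'a) \<in> B"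
proof -
  assume k: "k > 0" "k < p"
  hence nz: "of_nat k \<noteq> (0::'a)"
    using p(2) by (auto simp: of_nat_eq_0_iff_char_dvd dest: nat_dvd_not_less)
  obtain r where r: "p = Suc (Suc r)" using p_gt using less_imp_Suc_add[OF p_gt(1)] by auto
  have "(of_nat k :: 'a) * (of_nat k ^ r * of_nat k) = of_nat k"
    using of_nat_power_char[OF p, of k] unfolding r by (simp add: mult_ac)
  hence "of_nat k ^ r * of_nat k = (1::'a)" using nz by simp
  hence "inverse (of_nat k) = (of_nat k ^ r :: 'a)" using nz by (simp add: field_simps)
  moreover have "(of_nat k ^ r :: 'a) \<in> B" by (intro B_simps)
  ultimately show ?thesis using nz by simp
qed

text \<open>In a counterexample \<open>g\<close> of minimal degree, the derivative of \<open>g (\<theta> + \<rho> T)\<close> is constant modulo the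
  maximal ideal, up to a scalar. As \<open>deg g < p\<close>, this makes \<open>g (\<theta> + \<rho> T)\<close> itself linear.\<close>

lemma expansion_dominated_by_constant:
  assumes \<rho>: "\<rho> \<noteq> 0" "inverse \<rho> \<in> B" and far: "\<And>c. c \<in> K \<Longrightarrow> (\<theta> - c) / \<rho> \<notin> B"
    and g: "g \<in> polys_over K" "g \<noteq> 0" "degree g < p" and j: "j \<ge> 1"
  shows "coeff (pcompose g [:\<theta>, \<rho>:]) j / poly g \<theta> \<in> max_ideal B"
  using g j
proof (induction "degree g" arbitrary: g j rule: less_induct)
  case (less g j)
  define G where "G = pcompose g [:\<theta>, \<rho>:]"
  have G0: "coeff G 0 = poly g \<theta>" by (simp add: G_def)
  have degG: "degree G = degree g" using \<rho>(1) by (simp add: G_def degree_pcompose)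
  have g\<theta>: "poly g \<theta> \<noteq> 0" by (rule poly_nonzero) (use less.prems in auto)
  show ?case
  proof (rule ccontr)
    assume neg: "\<not> ?thesis"
    hence nm: "coeff G j / coeff G 0 \<notin> max_ideal B" by (simp add: G0 G_def)
    hence Gj: "coeff G j \<noteq> 0" "coeff G 0 / coeff G j \<in> B"
      using not_mB[OF nm] mB(1) by auto
    have d: "degree g \<ge> 1"
      using le_degree[OF Gj(1)] less.prems(4) degG by linarith
    define g' where "g' = pderiv g"
    have "coeff g' (degree g - 1) = of_nat (degree g) * lead_coeff g"
      using d by (simp add: g'_def coeff_pderiv)
    hence g'0: "g' \<noteq> 0"
      using inverse_of_nat_B[of "degree g"] less.prems d by auto
    have g'K: "g' \<in> polys_over K" unfolding g'_def by (intro polys_K less.prems)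
    have deg': "degree g' < degree g"
      using degree_pderiv_le[of g] d by (simp add: g'_def)
    have pG: "pderiv G = smult \<rho> (pcompose g' [:\<theta>, \<rho>:])"
      by (simp add: G_def pderiv_pcompose g'_def pderiv_pCons)
    have cG: "of_nat (Suc i) * coeff G (Suc i) = \<rho> * coeff (pcompose g' [:\<theta>, \<rho>:]) i" for i
      using arg_cong[OF pG, of "\<lambda>f. coeff f i"] by (simp add: coeff_pderiv)
    have g'\<theta>: "poly g' \<theta> \<noteq> 0" by (rule poly_nonzero) (use g'K g'0 deg' less.prems in auto)
    have G1: "coeff G 1 = \<rho> * poly g' \<theta>" using cG[of 0] by simp
    hence G10: "coeff G 1 \<noteq> 0" using \<rho>(1) g'\<theta> by simp
    \<comment> \<open>\<open>coeff G k\<close> is \<open>\<rho> / k\<close> times the coefficient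
      \<open>k - 1\<close> in the expansion of \<open>g'\<close>, which is dominated by
      \<open>g'(\<theta>)\<close> by induction; \<open>k\<close> is a unit because
      \<open>k \<le> degree g < p\<close>.\<close>
    have Gk: "coeff G k / coeff G 1 \<in> max_ideal B" if k: "k \<ge> 2" for k
    proof (cases "k \<le> degree g")
      case True
      obtain i where i: "k = Suc i" "i \<ge> 1" using k by (cases k) auto
      have inv: "of_nat k \<noteq> (0::'a)" "inverse (of_nat k :: 'a) \<in> B"
        using inverse_of_nat_B[of k] k True less.prems(3) by auto
      have "coeff (pcompose g' [:\<theta>, \<rho>:]) i / poly g' \<theta> \<in> max_ideal B"
        using less.hyps[OF deg' g'K g'0 _ i(2)] deg' less.prems(3) by simp
      hence "inverse (of_nat k) * (coeff (pcompose g' [:\<theta>, \<rho>:]) i / poly g' \<theta>) \<in> max_ideal B"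
        by (rule mB(4)[OF _ inv(2)])
      moreover have "coeff G k = inverse (of_nat k) * (\<rho> * coeff (pcompose g' [:\<theta>, \<rho>:]) i)"
        using cG[of i] inv(1) unfolding i(1) [symmetric] by (simp add: field_simps)
      hence "coeff G k / coeff G 1 = inverse (of_nat k) * (coeff (pcompose g' [:\<theta>, \<rho>:]) i / poly g' \<theta>)"
        unfolding G1 using \<rho>(1) by simp
      ultimately show ?thesis by simp
    next
      case False
      then show ?thesis using mB(1) degG by (simp add: coeff_eq_0)
    qed
    \<comment> \<open>For \<open>j > 1\<close> the violating coefficient is itself smaller than
      \<open>coeff G 1\<close>, so in either case \<open>coeff G 1\<close> bounds the constant
      term.\<close>
    have "coeff G 0 / coeff G 1 \<in> B"
    proof (cases "j = 1")
      case True
      then show ?thesis using Gj by simp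
    next
      case False
      hence "coeff G 0 / coeff G j * (coeff G j / coeff G 1) \<in> B"
        using less.prems(4) by (intro B_simps Gj mB(3) Gk) auto
      thus ?thesis using Gj(1) by simp
    qed
    hence "\<exists>c\<in>K. (\<theta> - c) / \<rho> \<in> B"
      using approximation_of_linear_reduction[OF \<rho> less.prems(1,3) G_def G10 _ Gk] by blast
    thus False using far by blast
  qed
qed

text \<open>Otherwise every \<open>\<theta> - c\<close> is larger than
  \<open>\<rho> = b / (\<sigma> b - b)\<close>, and the expansion of a polynomial representing
  \<open>b\<close> makes \<open>\<sigma> b - b\<close> smaller than it is.\<close>

lemma exists_AS_generator_dominating:
  assumes b: "b \<noteq> 0"
  shows "\<exists>c\<in>K. (\<sigma> b / b - 1) * (\<theta> - c) \<in> B"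
proof (rule ccontr)
  assume neg: "\<not> ?thesis"
  define \<delta> where "\<delta> = \<sigma> b / b - 1"
  have \<delta>0: "\<delta> \<noteq> 0"
  proof
    assume "\<delta> = 0"
    hence "\<delta> * (\<theta> - 0) \<in> B" using B_simps by simp
    with neg K_simps(1) show False unfolding \<delta>_def by blast
  qed
  define \<rho> where "\<rho> = inverse \<delta>"
  have \<rho>0: "\<rho> \<noteq> 0" using \<delta>0 by (simp add: \<rho>_def)
  have \<delta>B: "inverse \<rho> \<in> B"
    using \<sigma>n_ratio(1)[OF b, of 1] by (auto simp: \<rho>_def \<delta>_def intro: B_simps)
  have far: "(\<theta> - c) / \<rho> \<notin> B" if "c \<in> K" for c
    using neg that \<delta>0 by (auto simp: \<rho>_def \<delta>_def field_simps)
  obtain g where g: "g \<in> polys_over K" "degree g < p" "poly g \<theta> = b" using rep .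
  have g0: "g \<noteq> 0" using b g(3) by auto
  define G where "G = pcompose g [:\<theta>, \<rho>:]"
  have G0: "coeff G 0 = b" by (simp add: G_def g)
  have Gj: "coeff G (Suc j) / b \<in> max_ideal B" for j
    using expansion_dominated_by_constant[OF \<rho>0 \<delta>B far g(1) g0 g(2), of "Suc j"] by (simp add: G_def g)
  \<comment> \<open>At \<open>T = 1 / \<rho>\<close> the argument \<open>\<theta> + \<rho> T\<close>
    becomes \<open>\<theta> + 1\<close>, which is \<open>\<sigma> \<theta>\<close>.\<close>
  have "poly G (inverse \<rho>) = \<sigma> b"
    using \<rho>0 Gal_poly_K[OF \<sigma>(1) g(1), of \<theta>] by (simp add: G_def poly_pcompose \<sigma> g)
  moreover obtain G' where G': "G = pCons b G'" using G0 by (cases G) auto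
  ultimately have "inverse \<rho> * poly G' (inverse \<rho>) = \<sigma> b - b"
    by (metis add_diff_cancel_left' poly_pCons)
  also have "\<dots> = b * \<delta>" using b by (simp add: \<delta>_def right_diff_distrib)
  finally have "inverse \<rho> * poly G' (inverse \<rho>) = b * \<delta>" .
  hence "poly G' (inverse \<rho>) = b" using \<delta>0 by (simp add: \<rho>_def)
  hence "1 = (\<Sum>j\<le>degree G'. coeff G' j / b * inverse \<rho> ^ j)"
    using b by (simp add: poly_altdef sum_divide_distrib [symmetric])
  also have "\<dots> \<in> max_ideal B"
  proof -
    have *: "sum f I \<in> max_ideal B" if "\<And>i. i \<in> I \<Longrightarrow> f i \<in> max_ideal B" for f and I :: "nat set"
      using that by (induction I rule: infinite_finite_induct) (auto intro: mB(1) mB_add)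
    have "coeff G' j / b \<in> max_ideal B" for j using Gj[of j] by (simp add: G')
    thus ?thesis by (intro * mB(5) B_simps \<delta>B)
  qed
  finally show False using mB(2) by contradiction
qed

end

section \<open>Comparison of the two ideals\<close>

lemma gen_module_mono: "S \<subseteq> T \<Longrightarrow> gen_module R S \<subseteq> gen_module R T"
  unfolding gen_module_def by blast

lemma gen_module_scaled_subset:
  assumes R: "\<And>x y. x \<in> R \<Longrightarrow> y \<in> R \<Longrightarrow> x * y \<in> R"
    and T: "\<And>t. t \<in> T \<Longrightarrow> \<exists>a\<in>R. \<exists>s\<in>S. t = a * s"
  shows "gen_module R T \<subseteq> gen_module R S"
proof
  fix x assume "x \<in> gen_module R T"
  then obtain n :: nat and r t where x: "x = (\<Sum>i<n. r i * t i)" and rt: "\<And>i. i < n \<Longrightarrow> r i \<in> R \<and> t i \<in> T"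
    by (auto simp: gen_module_def)
  have "\<forall>i\<in>{..<n}. \<exists>a s. a \<in> R \<and> s \<in> S \<and> t i = a * s" using T rt by blast
  then obtain a s where as: "\<And>i. i < n \<Longrightarrow> a i \<in> R \<and> s i \<in> S \<and> t i = a i * s i" by (metis lessThan_iff)
  have "x = (\<Sum>i<n. (r i * a i) * s i)"
    unfolding x by (intro sum.cong) (auto simp: as mult.assoc)
  moreover have "r i * a i \<in> R \<and> s i \<in> S" if "i < n" for i
    using as[OF that] rt[OF that] R by blast
  ultimately show "x \<in> gen_module R S"
    unfolding gen_module_def
    by (intro CollectI exI[of _ n] exI[of _ "\<lambda>i. r i * a i"] exI[of _ s]) blast
qed

context AS_valued
begin

text \<open>Each summand has its own generator \<open>\<theta> - c\<close>; of two such generators,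
  the one of smaller absolute value serves for both summands.\<close>

lemma J_sigma_generator:
  assumes "x \<in> J_sigma B \<sigma>"
  shows "\<exists>c\<in>K. x * (\<theta> - c) \<in> B"
proof -
  have "\<exists>(n::nat) r s. x = (\<Sum>i<n. r i * s i) \<and> (\<forall>i<n. r i \<in> B \<and> s i \<in> {\<sigma> b / b - 1 | b. b \<noteq> 0})"
    using assms by (simp only: J_sigma_def gen_module_def mem_Collect_eq)
  then obtain n :: nat and r s where x: "x = (\<Sum>i<n. r i * s i)"
    and "\<forall>i<n. r i \<in> B \<and> s i \<in> {\<sigma> b / b - 1 | b. b \<noteq> 0}"
    by blast
  hence rs: "\<And>i. i < n \<Longrightarrow> r i \<in> B" "\<And>i. i < n \<Longrightarrow> \<exists>b. b \<noteq> 0 \<and> s i = \<sigma> b / b - 1"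
    by auto
  have "\<exists>c\<in>K. (\<Sum>i<m. r i * s i) * (\<theta> - c) \<in> B" if "m \<le> n" for m
    using that
  proof (induction m)
    case 0
    show ?case using K_simps(1) B_simps(1) by auto
  next
    case (Suc m)
    define y where "y = (\<Sum>i<m. r i * s i)"
    define z where "z = r m * s m"
    obtain c where c: "c \<in> K" "y * (\<theta> - c) \<in> B" using Suc by (auto simp: y_def)
    obtain b where b: "b \<noteq> 0" "s m = \<sigma> b / b - 1" using rs(2)[of m] Suc.prems by auto
    then obtain c' where c': "c' \<in> K" "s m * (\<theta> - c') \<in> B"
      using exists_AS_generator_dominating[OF b(1)] by auto
    have "r m * (s m * (\<theta> - c')) \<in> B" by (intro B_simps rs(1) c') (use Suc.prems in simp)
    hence z: "z * (\<theta> - c') \<in> B" by (simp add: z_def mult.assoc)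
    have nz: "\<theta> - c \<noteq> 0" "\<theta> - c' \<noteq> 0" using \<theta>(2) c(1) c'(1) by auto
    show ?case
    proof (cases "(\<theta> - c) / (\<theta> - c') \<in> B")
      case True
      have "z * (\<theta> - c') * ((\<theta> - c) / (\<theta> - c')) + y * (\<theta> - c) \<in> B"
        by (intro B_simps z True c)
      moreover have "z * (\<theta> - c') * ((\<theta> - c) / (\<theta> - c')) = z * (\<theta> - c)" using nz by simp
      ultimately have "(y + z) * (\<theta> - c) \<in> B" by (simp only: distrib_right add.commute)
      thus ?thesis using c(1) by (auto simp: y_def z_def)
    next
      case False
      hence "(\<theta> - c') / (\<theta> - c) \<in> B" using mB(3)[OF mB_or[OF False]] by simp
      hence "y * (\<theta> - c) * ((\<theta> - c') / (\<theta> - c)) + z * (\<theta> - c') \<in> B"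
        by (intro B_simps z c)
      moreover have "y * (\<theta> - c) * ((\<theta> - c') / (\<theta> - c)) = y * (\<theta> - c')" using nz by simp
      ultimately have "(y + z) * (\<theta> - c') \<in> B" by (simp only: distrib_right)
      thus ?thesis using c'(1) by (auto simp: y_def z_def)
    qed
  qed
  thus ?thesis unfolding x by blast
qed

text \<open>For \<open>c\<close> from \<open>J_sigma_generator\<close>, \<open>N(x)\<close> is the
  product of \<open>N(x (\<theta> - c))\<close>, which lies in \<open>A\<close>, and
  \<open>1 / N(\<theta> - c)\<close>, where \<open>\<theta> - c\<close> is again an Artin--Schreier
  generator.\<close>

lemma norm_J_sigma:
  assumes "x \<in> J_sigma B \<sigma>"
  shows "\<exists>a\<in>A. \<exists>s\<in>{1 / h | h. h \<in> K \<and> h \<noteq> 0 \<and> adjoin K {\<theta>. \<theta> ^ p - \<theta> = h} = UNIV}. norm_LK K x = a * s"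
proof -
  obtain c where c: "c \<in> K" "x * (\<theta> - c) \<in> B" using J_sigma_generator[OF assms] by blast
  define h where "h = norm_LK K (\<theta> - c)"
  have h: "h \<in> K" "h \<noteq> 0" "h = (\<theta> - c) ^ p - (\<theta> - c)"
  proof -
    show "h \<in> K" unfolding h_def by (rule norm_in_K)
    show "h \<noteq> 0" using \<theta>(2) c(1) by (auto simp: h_def norm_zero_iff)
    show "h = (\<theta> - c) ^ p - (\<theta> - c)"
      unfolding h_def by (rule norm_translate[OF AS_extension_translate(2)[OF c(1)]])
  qed
  have "adjoin K {\<theta>. \<theta> ^ p - \<theta> = h} = UNIV"
    by (rule adjoin_AS_UNIV_I[OF AS_extension_translate(1)[OF c(1)]]) (simp add: h(3))
  moreover have "norm_LK K x = norm_LK K (x * (\<theta> - c)) * (1 / h)"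
    using h(2) by (simp add: norm_mult h_def)
  ultimately show ?thesis using norm_A[OF c(2)] h(1,2) by blast
qed

end

text \<open>Here \<theta> is any generator, so \<open>\<sigma> \<theta> = \<theta> + j\<close>. As
  \<open>j\<close> is a unit of \<open>B\<close>, the element \<open>1 / \<theta>\<close>, equal to
  \<open>1 / j\<close> times \<open>\<sigma> \<theta> / \<theta> - 1\<close>, lies in the ideal, and
  its norm is the desired one.\<close>

lemma (in AS_extension) inverse_in_norm_J_sigma:
  assumes \<sigma>: "generates_Gal K \<sigma>" and A: "valuation_ring_of A K" "henselian A"
  shows "1 / (\<theta> ^ p - \<theta>) \<in> norm_LK K ` J_sigma (integral_closure A) \<sigma>"
proof -
  obtain j where j: "0 < j" "j < p" "\<sigma> \<theta> = \<theta> + of_nat j" "AS_galois p K (\<theta> / of_nat j) \<sigma>"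
    using AS_galois_rescale[OF \<sigma>] .
  interpret G: AS_valued p K "\<theta> / of_nat j" \<sigma> A
    by (intro AS_valued.intro j(4) AS_valued_axioms.intro A)
  have inv: "of_nat j \<noteq> (0::'a)" "inverse (of_nat j :: 'a) \<in> G.B"
    using G.inverse_of_nat_B[OF j(1,2)] by auto
  have \<theta>0: "\<theta> \<noteq> 0" using \<theta>(2) K_simps(1) by auto
  have "norm_LK K \<theta> = norm_LK K (of_nat j) * norm_LK K (\<theta> / of_nat j)"
    using inv(1) by (simp flip: G.norm_mult)
  also have "norm_LK K (\<theta> / of_nat j) = (\<theta> ^ p - \<theta>) / of_nat j"
    using G.norm_translate[OF G.\<sigma>(2)]
    by (simp add: power_divide of_nat_power_char[OF p] diff_divide_distrib)
  also have "norm_LK K (of_nat j) = of_nat j"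
    using G.norm_K[OF K_simps(10)] by (simp add: of_nat_power_char[OF p])
  finally have N: "norm_LK K \<theta> = \<theta> ^ p - \<theta>" using inv(1) by simp
  have "1 / \<theta> = inverse (of_nat j) * (\<sigma> \<theta> / \<theta> - 1)"
    using inv(1) \<theta>0 j(3) by (simp add: field_simps)
  hence "1 / \<theta> \<in> J_sigma G.B \<sigma>"
    unfolding J_sigma_def gen_module_def using inv(2) \<theta>0
    by (intro CollectI exI[of _ "1::nat"] exI[of _ "\<lambda>_. inverse (of_nat j)"] exI[of _ "\<lambda>_. \<sigma> \<theta> / \<theta> - 1"]) auto
  moreover have "norm_LK K (1 / \<theta>) = 1 / (\<theta> ^ p - \<theta>)"
    using G.norm_K[OF K_simps(2)] by (simp add: G.norm_divide N)
  ultimately show ?thesis by (metis image_eqI)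
qed

theorem theorem4p3p1:
  fixes p :: nat and K A :: "'a::field set" and \<sigma> :: "'a \<Rightarrow> 'a"
  assumes "prime p"
    and "CHAR('a) = p"
    and "is_subfield K"
    and "valuation_ring_of A K"
    and "fraction_field_of A K"
    and "henselian A"
    and "A \<noteq> K"
    and "nontrivial_AS_ext p K"
    and "generates_Gal K \<sigma>"
  shows "H_module p A K =
    gen_module A (norm_LK K ` J_sigma (integral_closure A) \<sigma>)"
proof
  obtain h0 where K: "K \<noteq> UNIV" and h0: "h0 \<in> K" "adjoin K {\<theta>. \<theta> ^ p - \<theta> = h0} = UNIV"
    using assms(8) unfolding nontrivial_AS_ext_def by blast
  note AS = adjoin_AS_UNIV_D[OF assms(1-3) K]
  show "H_module p A K \<subseteq> gen_module A (norm_LK K ` J_sigma (integral_closure A) \<sigma>)"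
    unfolding H_module_def
  proof (rule gen_module_mono, safe)
    fix h assume h: "h \<in> K" "adjoin K {\<theta>. \<theta> ^ p - \<theta> = h} = UNIV"
    obtain \<theta> where \<theta>: "\<theta> ^ p - \<theta> = h" "AS_extension p K \<theta>" using AS[OF h] .
    thus "1 / h \<in> norm_LK K ` J_sigma (integral_closure A) \<sigma>"
      using AS_extension.inverse_in_norm_J_sigma[OF \<theta>(2) assms(9,4,6)] by simp
  qed
  \<comment> \<open>For this inclusion one generator is enough: after scaling, its translates by
    elements of \<open>K\<close> supply all the \<open>h\<close> that occur.\<close>
  obtain \<theta> where \<theta>: "\<theta> ^ p - \<theta> = h0" "AS_extension p K \<theta>" using AS[OF h0] .
  obtain j where "AS_galois p K (\<theta> / of_nat j) \<sigma>"
    using AS_extension.AS_galois_rescale[OF \<theta>(2) assms(9)] .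
  then interpret AS_valued p K "\<theta> / of_nat j" \<sigma> A
    by (intro AS_valued.intro AS_valued_axioms.intro assms)
  show "gen_module A (norm_LK K ` J_sigma (integral_closure A) \<sigma>) \<subseteq> H_module p A K"
    unfolding H_module_def
    by (rule gen_module_scaled_subset) (use A_simps(5) norm_J_sigma in auto)
qed

end
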